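(* With $S_1,S_2$ as in the context, $$S_1(q)=\frac{(q^4;q^4)_\infty}{(q^3;q^3)_\infty (q^6;q^{12})_\infty} \left(2\frac{(-q^4;q^4)_\infty^2}{(q^{24},q^{96};q^{120})_\infty} +q\frac{(-q^2;q^4)_\infty^2}{(q^{12},-q^{18};-q^{30})_\infty} \right),$$ $$S_2(q)=\frac{(q^4;q^4)_\infty}{(q^3;q^3)_\infty (q^6;q^{12})_\infty} \left(\frac{(-q^2;q^4)_\infty^2}{(-q^6,q^{24};-q^{30})_\infty} +2q^5\frac{(-q^4;q^4)_\infty^2}{(q^{48},q^{72};q^{120})_\infty} \right).$$
   Context: Let $|q|<1$ and use standard $q$-Pochhammer notation $(a;q)_n=\prod_{k=0}^{n-1}(1-aq^k)$, $(a;q)_\infty=\prod_{k\ge0}(1-aq^k)$, $(a_1,\dots,a_m;q)_\infty=(a_1;q)_\infty\cdots(a_m;q)_\infty$ (also with base $-q^{30}$ in place of $q$). Define $$S_1(q)=\sum_{i,j\geq 0}\frac{q^{\frac{1}{2}i^2-ij+2j^2-\frac{1}{2}i+2j}}{(q^3;q^3)_i(q^3;q^3)_j},\qquad S_2(q)=\sum_{i,j\geq 0}\frac{q^{\frac{1}{2}i^2-ij+2j^2+\frac{3}{2}i}}{(q^3;q^3)_i (q^3;q^3)_j}.$$ *)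

theory Defs
  imports "HOL-Analysis.Analysis"
begin

definition qpoch :: "complex \<Rightarrow> complex \<Rightarrow> nat \<Rightarrow> complex" where
  "qpoch a q n = (\<Prod>k<n. 1 - a * q ^ k)"

definition qpoch_inf :: "complex \<Rightarrow> complex \<Rightarrow> complex" where
  "qpoch_inf a q = (\<Prod>k. 1 - a * q ^ k)"

text \<open>The exponents 1/2 i^2 - i j + 2 j^2 - 1/2 i + 2 j and 1/2 i^2 - i j + 2 j^2 + 3/2 i
  are integers; they are written with exact integer division of an even number.\<close>
definition S1 :: "complex \<Rightarrow> complex" where
  "S1 q = (\<Sum>\<^sub>\<infinity>(i,j)\<in>(UNIV :: (nat \<times> nat) set).
      q powi ((int i ^ 2 - int i) div 2 - int i * int j + 2 * int j ^ 2 + 2 * int j)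
      / (qpoch (q^3) (q^3) i * qpoch (q^3) (q^3) j))"

definition S2 :: "complex \<Rightarrow> complex" where
  "S2 q = (\<Sum>\<^sub>\<infinity>(i,j)\<in>(UNIV :: (nat \<times> nat) set).
      q powi ((int i ^ 2 + 3 * int i) div 2 - int i * int j + 2 * int j ^ 2)
      / (qpoch (q^3) (q^3) i * qpoch (q^3) (q^3) j))"

end

theory Submission
  imports Defs
begin

text \<open>
  Write \<open>Q = q\<^sup>3\<close>, \<open>x = q\<^sup>6\<close> and \<open>t(n) = n(n-1)/2\<close>. Both exponents have the form \<open>e(i - j) + 3 t(j + 1)\<close>
  with \<open>e\<close> quadratic. Since \<open>1/(z;Q)\<^sub>\<infinity> = (-z;Q)\<^sub>\<infinity> / (z\<^sup>2;Q\<^sup>2)\<^sub>\<infinity>\<close>, the factor \<open>1/(Q;Q)\<^sub>i\<close> can be expanded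
  so that the sum over \<open>i - j\<close> becomes a product of two Euler series, that is, a theta series in
  base \<open>Q\<close>. Together with the theta series from \<open>e\<close> this leaves a quadratic form which a shift
  diagonalises: the double sum is \<open>1/(Q;Q)\<^sub>\<infinity>\<close> times \<open>\<Sum>\<^sub>k x\<^bsup>k\<^sup>2/4 + \<dots>\<^esup> / (x;x)\<^sub>k\<close> times a theta
  constant in \<open>q\<close> that depends only on the parity of \<open>k\<close>.

  The even and odd parts of the sum over \<open>k\<close> are Slater's identities (79), (94), (96), (99). With
  \<open>x = y\<^sup>4\<close> they are the even and odd parts in \<open>y\<close> of \<open>\<Sum>\<^sub>k y\<^bsup>k\<^sup>2 + 2ck\<^esup> / (y\<^sup>4;y\<^sup>4)\<^sub>k\<close>, which equals a
  Rogers--Ramanujan function of \<open>y\<close> divided by \<open>(-y\<^sup>2;y\<^sup>2)\<^sub>\<infinity>\<close>; the factors of its product with odd powers of \<open>y\<close>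
  combine to a theta series whose dissection is immediate.

  The triple product and the Rogers--Ramanujan identities both come from Durfee's identity
  \<open>\<Sum>\<^sub>j q\<^bsup>j\<^sup>2 + mj\<^esup> / ((q;q)\<^sub>j (q;q)\<^sub>j\<^sub>+\<^sub>m) = 1/(q;q)\<^sub>\<infinity>\<close>.
\<close>

section \<open>q-Pochhammer symbols\<close>

lemma qpoch_0 [simp]: "qpoch a q 0 = 1"
  by (simp add: qpoch_def)

lemma qpoch_Suc: "qpoch a q (Suc n) = qpoch a q n * (1 - a * q ^ n)"
  by (simp add: qpoch_def)

lemma qpoch_add: "qpoch a q (m + n) = qpoch a q m * qpoch (a * q ^ m) q n"
  by (induction n) (simp_all add: qpoch_Suc power_add mult.assoc)

lemma qpoch_split: "qpoch a q (m * n) = (\<Prod>i<m. qpoch (a * q ^ i) (q ^ m) n)"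
proof (induction n)
  case (Suc n)
  have "qpoch a q (m * Suc n) = qpoch a q (m * n) * qpoch (a * q ^ (m * n)) q m"
    by (metis add.commute mult_Suc_right qpoch_add)
  also have "\<dots> = (\<Prod>i<m. qpoch (a * q ^ i) (q ^ m) n) * (\<Prod>i<m. 1 - a * q ^ i * (q ^ m) ^ n)"
    unfolding Suc by (simp add: qpoch_def [of _ _ m] mult_ac power_mult power_add)
  finally show ?case by (simp add: qpoch_Suc prod.distrib)
qed simp

lemma qpoch_minus: "qpoch a q n * qpoch (- a) q n = qpoch (a\<^sup>2) (q\<^sup>2) n"
  by (simp add: qpoch_def prod.distrib [symmetric] power2_eq_square power_mult_distrib algebra_simps)

section \<open>Infinite products: convergence, nonvanishing and splitting\<close>

lemma convergent_prod_qpoch: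
  fixes a q :: complex
  assumes "norm q < 1"
  shows "convergent_prod (\<lambda>k. 1 - a * q ^ k)"
proof -
  have "summable (\<lambda>k. norm a * norm q ^ k)"
    using assms by (intro summable_mult summable_geometric) simp
  then have "abs_convergent_prod (\<lambda>k. 1 - a * q ^ k)"
    by (simp add: abs_convergent_prod_conv_summable norm_mult norm_power)
  then show ?thesis
    by (rule abs_convergent_prod_imp_convergent_prod)
qed

lemma qpoch_tendsto:
  assumes "norm q < 1"
  shows "qpoch a q \<longlonglongrightarrow> qpoch_inf a q"
  using has_prod_imp_tendsto' [OF convergent_prod_has_prod [OF convergent_prod_qpoch [OF assms, of a]]]
  unfolding qpoch_def qpoch_inf_def .

lemma qpoch_inf_unique:
  assumes "norm q < 1" "qpoch a q \<longlonglongrightarrow> L"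
  shows "qpoch_inf a q = L"
  using LIMSEQ_unique qpoch_tendsto assms by blast

lemma qpoch_inf_nonzero:
  assumes "norm q < 1" "norm a < 1"
  shows "qpoch_inf a q \<noteq> 0"
  unfolding qpoch_inf_def
proof (rule prodinf_nonzero [OF convergent_prod_qpoch [OF assms(1)]])
  fix k
  have "norm (a * q ^ k) < 1"
    using assms by (simp add: norm_mult norm_power power_le_one mult_le_one order.strict_trans1
        [OF mult_left_le])
  then show "1 - a * q ^ k \<noteq> 0" by force
qed

lemma qpoch_nonzero:
  assumes "norm q < 1" "norm a < 1"
  shows "qpoch a q n \<noteq> 0"
proof -
  have "norm (a * q ^ k) < 1" for k
    using assms by (simp add: norm_mult norm_power power_le_one mult_le_one order.strict_trans1
        [OF mult_left_le])
  then have "1 - a * q ^ k \<noteq> 0" for k by (metis norm_one order.irrefl right_minus_eq)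
  then show ?thesis by (simp add: qpoch_def)
qed

lemma qpoch_inf_0 [simp]: "qpoch_inf 0 q = 1"
  by (simp add: qpoch_inf_def)

lemma qpoch_inf_add:
  assumes "norm q < 1"
  shows "qpoch_inf a q = qpoch a q m * qpoch_inf (a * q ^ m) q"
proof (rule qpoch_inf_unique [OF assms])
  have "(\<lambda>n. qpoch a q m * qpoch (a * q ^ m) q n) \<longlonglongrightarrow> qpoch a q m * qpoch_inf (a * q ^ m) q"
    by (intro tendsto_intros qpoch_tendsto assms)
  then have "(\<lambda>n. qpoch a q (n + m)) \<longlonglongrightarrow> qpoch a q m * qpoch_inf (a * q ^ m) q"
    by (simp add: qpoch_add [symmetric] add.commute)
  then show "qpoch a q \<longlonglongrightarrow> qpoch a q m * qpoch_inf (a * q ^ m) q"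
    by (rule LIMSEQ_offset)
qed

lemma norm_power_less_one:
  fixes q :: "'a :: real_normed_div_algebra"
  assumes "norm q < 1" "m > 0"
  shows "norm (q ^ m) < 1"
  using assms by (simp add: norm_power power_less_one_iff)

lemma qpoch_inf_split:
  assumes "norm q < 1" "m > 0"
  shows "qpoch_inf a q = (\<Prod>i<m. qpoch_inf (a * q ^ i) (q ^ m))"
proof (rule LIMSEQ_unique)
  have "filterlim (\<lambda>n. m * n) sequentially sequentially"
    using assms by (simp add: mult.commute[of m] filterlim_subseq strict_mono_def)
  then show "(\<lambda>n. qpoch a q (m * n)) \<longlonglongrightarrow> qpoch_inf a q"
    by (rule filterlim_compose [OF qpoch_tendsto [OF assms(1)]])
  show "(\<lambda>n. qpoch a q (m * n)) \<longlonglongrightarrow> (\<Prod>i<m. qpoch_inf (a * q ^ i) (q ^ m))"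
    unfolding qpoch_split
    by (intro tendsto_prod qpoch_tendsto norm_power_less_one assms)
qed

lemma qpoch_inf_minus:
  assumes "norm q < 1"
  shows "qpoch_inf a q * qpoch_inf (- a) q = qpoch_inf (a\<^sup>2) (q\<^sup>2)"
proof (rule LIMSEQ_unique)
  show "(\<lambda>n. qpoch a q n * qpoch (- a) q n) \<longlonglongrightarrow> qpoch_inf a q * qpoch_inf (- a) q"
    by (intro tendsto_mult qpoch_tendsto assms)
  show "(\<lambda>n. qpoch a q n * qpoch (- a) q n) \<longlonglongrightarrow> qpoch_inf (a\<^sup>2) (q\<^sup>2)"
    unfolding qpoch_minus by (intro qpoch_tendsto norm_power_less_one assms) simp
qed

text \<open>The symbols converge to a nonzero limit, so their reciprocals converge and are bounded.
  This uniform bound dominates the later series with Pochhammer denominators.\<close>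

lemma qpoch_inverse_bound:
  assumes "norm q < 1" "norm a < 1"
  obtains C where "C > 0" "\<And>n. norm (inverse (qpoch a q n)) \<le> C"
proof -
  have "(\<lambda>n. inverse (qpoch a q n)) \<longlonglongrightarrow> inverse (qpoch_inf a q)"
    by (intro tendsto_inverse qpoch_tendsto qpoch_inf_nonzero assms)
  then have "Bseq (\<lambda>n. inverse (qpoch a q n))"
    by (rule convergent_imp_Bseq [OF convergentI])
  then show ?thesis
    using that unfolding Bseq_def by blast
qed

section \<open>Triangular exponents\<close>

text \<open>The binomial coefficient \<open>n\<close> over 2, continued to all integers so that one
  formula serves both halves of a bilateral theta series.\<close>

definition tri :: "int \<Rightarrow> int" where
  "tri n = n * (n - 1) div 2"

text \<open>Exponent identities are checked below in doubled form: this equation removes the integer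
  division and leaves a polynomial identity.\<close>

lemma two_tri: "2 * tri n = n * (n - 1)"
  unfolding tri_def by (simp add: even_mult_iff)

lemma tri_eqI: "2 * a = n * (n - 1) \<Longrightarrow> tri n = a"
  using two_tri[of n] by simp

lemma tri_simps [simp]: "tri 0 = 0" "tri 1 = 0"
  by (simp_all add: tri_def)

lemma tri_add: "tri (m + n) = tri m + tri n + m * n"
proof (rule tri_eqI)
  show "2 * (tri m + tri n + m * n) = (m + n) * (m + n - 1)"
    using two_tri[of m] two_tri[of n] by (simp add: algebra_simps)
qed

lemma powi_tri_Suc:
  fixes q :: "'a :: field"
  shows "q \<noteq> 0 \<Longrightarrow> q powi tri (1 + int n) = q powi tri (int n) * q ^ n"
  using tri_add [of 1 "int n"] by (simp add: power_int_add)

lemma tri_one_minus: "tri (1 - n) = tri n"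
  by (rule tri_eqI) (simp only: two_tri, simp add: algebra_simps)

lemma tri_nonneg [simp]: "tri n \<ge> 0"
proof -
  have "n * (n - 1) \<ge> 0"
    by (cases "n \<ge> 1") (simp_all add: mult_nonpos_nonpos)
  then show ?thesis by (simp add: tri_def)
qed

lemma norm_powi_le_one:
  fixes q :: "'a :: real_normed_div_algebra"
  assumes "norm q < 1" "n \<ge> 0"
  shows "norm (q powi n) \<le> 1"
  using assms by (simp add: norm_power_int power_int_le_one)

lemma norm_powi_tri_le:
  fixes q :: "'a :: real_normed_div_algebra"
  assumes "norm q < 1"
  shows "norm (q powi tri n) \<le> 1"
  using assms by (simp add: norm_powi_le_one)

text \<open>Ratio test: consecutive terms have ratio \<open>q ^ n * z\<close>, which tends to 0
  however large \<open>z\<close> is.\<close>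

lemma summable_powi_tri_nat:
  fixes q z :: complex
  assumes q: "norm q < 1" "q \<noteq> 0"
  shows "summable (\<lambda>n. norm (q powi tri (int n) * z ^ n))"
proof -
  have "(\<lambda>n. norm q ^ n * norm z) \<longlonglongrightarrow> 0 * norm z"
    using q by (intro tendsto_intros LIMSEQ_power_zero) simp
  then have "eventually (\<lambda>n. norm q ^ n * norm z < 1/2) sequentially"
    by (intro order_tendstoD) auto
  then obtain N where N: "\<And>n. n \<ge> N \<Longrightarrow> norm q ^ n * norm z < 1/2"
    by (auto simp: eventually_sequentially)
  show ?thesis
  proof (rule summable_ratio_test)
    show "(1/2 :: real) < 1" by simp
    fix n assume "n \<ge> N"
    have *: "q powi tri (int (Suc n)) * z ^ Suc n = (q powi tri (int n) * z ^ n) * (q ^ n * z)"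
      using q by (simp add: powi_tri_Suc)
    then have "norm (q powi tri (int (Suc n)) * z ^ Suc n)
        = (norm q ^ n * norm z) * norm (q powi tri (int n) * z ^ n)"
      unfolding * by (simp add: norm_mult norm_power)
    also have "\<dots> \<le> 1/2 * norm (q powi tri (int n) * z ^ n)"
      using N [OF \<open>n \<ge> N\<close>] by (intro mult_right_mono) auto
    finally show "norm (norm (q powi tri (int (Suc n)) * z ^ Suc n))
        \<le> 1/2 * norm (norm (q powi tri (int n) * z ^ n))" by simp
  qed
qed

lemma summable_on_int:
  fixes f :: "int \<Rightarrow> complex"
  assumes "(\<lambda>n. f (int n)) summable_on UNIV" "(\<lambda>n. f (- int n)) summable_on UNIV"
  shows "f summable_on UNIV"
proof -
  have "f summable_on range int"
    using assms(1) by (subst summable_on_reindex) (auto simp: o_def)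
  moreover have "f summable_on range (\<lambda>n. - int n)"
    using assms(2) by (subst summable_on_reindex) (auto simp: o_def inj_def)
  ultimately have "f summable_on (range int \<union> range (\<lambda>n. - int n))"
    by (rule summable_on_union)
  also have "range int \<union> range (\<lambda>n. - int n) = UNIV"
    by (metis (no_types, lifting) UNIV_eq_I UnCI int_cases2 rangeI)
  finally show ?thesis .
qed

text \<open>The negative half is again a one-sided series of the same kind, with
  \<open>q / z\<close> in place of \<open>z\<close>.\<close>

lemma summable_powi_tri:
  fixes q z :: complex
  assumes q: "norm q < 1" "q \<noteq> 0"
  shows "(\<lambda>m. q powi tri m * z powi m) summable_on UNIV"
proof (rule summable_on_int)
  show "(\<lambda>n. q powi tri (int n) * z powi int n) summable_on UNIV"
    using summable_powi_tri_nat [OF q] by (intro norm_summable_imp_summable_on) simp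
  have "q powi tri (- int n) * z powi (- int n) = q powi tri (int n) * (q / z) ^ n" for n
  proof -
    have "tri (- int n) = tri (int n) + int n"
      by (rule tri_eqI) (simp add: distrib_left two_tri, simp add: algebra_simps)
    then show ?thesis
      using q by (simp add: power_int_add power_divide power_int_minus field_simps)
  qed
  then show "(\<lambda>n. q powi tri (- int n) * z powi (- int n)) summable_on UNIV"
    using summable_powi_tri_nat [OF q] by (intro norm_summable_imp_summable_on) simp
qed

section \<open>Euler's and Durfee's identities\<close>

lemma euler_summable:
  assumes q: "norm q < 1" "q \<noteq> 0"
  shows "summable (\<lambda>n. norm (q powi tri (int n) * z ^ n / qpoch q q n))"
proof -
  obtain C where C: "\<And>n. norm (inverse (qpoch q q n)) \<le> C"
    using qpoch_inverse_bound q by metis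
  show ?thesis
  proof (rule summable_comparison_test')
    show "summable (\<lambda>n. norm (q powi tri (int n) * z ^ n) * C)"
      by (intro summable_mult2 summable_powi_tri_nat q)
    show "norm (norm (q powi tri (int n) * z ^ n / qpoch q q n))
        \<le> norm (q powi tri (int n) * z ^ n) * C" for n
      using mult_left_mono [OF C [of n] norm_ge_zero [of "q powi tri (int n) * z ^ n"]]
      by (simp add: divide_inverse norm_mult)
  qed
qed

text \<open>The series satisfies \<open>E z = (1 + z) * E (z * q)\<close>. Iterating peels off the
  factors of the product, and continuity of \<open>E\<close> at 0 together with
  \<open>E 0 = 1\<close> gives the limit.\<close>

lemma euler_identity:
  assumes q: "norm q < 1" "q \<noteq> 0"
  shows "(\<lambda>n. q powi tri (int n) * z ^ n / qpoch q q n) sums qpoch_inf (- z) q"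
proof -
  define e where "e n = q powi tri (int n) / qpoch q q n" for n
  define E where "E z = (\<Sum>n. e n * z ^ n)" for z
  have summ: "summable (\<lambda>n. e n * z ^ n)" for z
    using summable_norm_cancel [OF euler_summable [OF q, of z]] by (simp add: e_def)
  have e_Suc: "e (Suc n) * (1 - q ^ Suc n) = e n * q ^ n" for n
  proof -
    have "1 - q * q ^ n \<noteq> 0"
      using qpoch_nonzero [OF q(1) q(1), of "Suc n"] by (auto simp: qpoch_Suc)
    then show ?thesis
      using q by (simp add: e_def qpoch_Suc powi_tri_Suc)
  qed
  have E_rec: "E z = (1 + z) * E (z * q)" for z
  proof -
    have "E z - E (z * q) = (\<Sum>n. e n * z ^ n - e n * (z * q) ^ n)"
      unfolding E_def by (rule suminf_diff [OF summ summ])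
    also have "\<dots> = (\<Sum>n. e n * (1 - q ^ n) * z ^ n)"
      by (simp add: algebra_simps power_mult_distrib)
    also have "\<dots> = (\<Sum>n. e (Suc n) * (1 - q ^ Suc n) * z ^ Suc n)"
    proof -
      have "summable (\<lambda>n. e n * (1 - q ^ n) * z ^ n)"
        using summable_diff [OF summ [of z] summ [of "z * q"]]
        by (simp add: algebra_simps power_mult_distrib)
      from suminf_split_head [OF this] show ?thesis by simp
    qed
    also have "\<dots> = (\<Sum>n. z * (e n * (z * q) ^ n))"
      unfolding e_Suc by (simp add: algebra_simps power_mult_distrib)
    also have "\<dots> = z * E (z * q)"
      unfolding E_def by (rule suminf_mult [OF summ])
    finally show ?thesis by (simp add: algebra_simps)
  qed
  have E_n: "E z = qpoch (- z) q n * E (z * q ^ n)" for n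
    by (induction n) (simp_all add: qpoch_Suc E_rec [of "z * q ^ _"] mult_ac)
  have "isCont E 0"
    unfolding E_def by (rule isCont_powser_converges_everywhere [OF summ])
  moreover have "(\<lambda>n. z * q ^ n) \<longlonglongrightarrow> z * 0"
    using q by (intro tendsto_intros LIMSEQ_power_zero) simp
  ultimately have "(\<lambda>n. E (z * q ^ n)) \<longlonglongrightarrow> E 0"
    using isCont_tendsto_compose [of 0 E] by simp
  then have "(\<lambda>n. qpoch (- z) q n * E (z * q ^ n)) \<longlonglongrightarrow> qpoch_inf (- z) q * E 0"
    by (intro tendsto_mult qpoch_tendsto q)
  then have "E z = qpoch_inf (- z) q * E 0"
    unfolding E_n [symmetric] by (simp add: LIMSEQ_const_iff)
  moreover have "E 0 = 1"
    unfolding E_def powser_zero by (simp add: e_def)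
  ultimately have "E z = qpoch_inf (- z) q" by simp
  then show ?thesis
    using summable_sums [OF summ [of z]] by (simp add: E_def e_def)
qed

text \<open>The generating function of the partitions whose largest rectangle of shape
  \<open>j\<close> by \<open>j + m\<close> has this \<open>j\<close>; for \<open>m = 0\<close> this
  is the Durfee square.\<close>

definition durfee_term :: "complex \<Rightarrow> nat \<Rightarrow> nat \<Rightarrow> complex" where
  "durfee_term q m j = q ^ (j * j + m * j) / (qpoch q q j * qpoch q q (j + m))"

lemma durfee_term_bound:
  assumes "norm q < 1"
  obtains C where "C > 0" "\<And>m j. norm (durfee_term q m j) \<le> C * norm q ^ (j * j + m * j)"
proof -
  obtain C where C: "C > 0" "\<And>n. norm (inverse (qpoch q q n)) \<le> C"
    using qpoch_inverse_bound [OF assms assms] by metis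
  have "norm (durfee_term q m j) \<le> (C * C) * norm q ^ (j * j + m * j)" for m j
  proof -
    have "norm (durfee_term q m j) = norm (inverse (qpoch q q j)) * norm (inverse (qpoch q q (j + m)))
        * norm q ^ (j * j + m * j)"
      by (simp add: durfee_term_def norm_mult norm_divide norm_power norm_inverse field_simps)
    also have "\<dots> \<le> (C * C) * norm q ^ (j * j + m * j)"
      using C by (intro mult_right_mono mult_mono) (auto intro: order.strict_implies_order)
    finally show ?thesis .
  qed
  with C(1) show ?thesis by (intro that [of "C * C"]) auto
qed

lemma durfee_term_bound':
  assumes "norm q < 1"
  obtains C where "C > 0" "\<And>m j. norm (durfee_term q m j) \<le> C * norm q ^ j"
proof -
  obtain C where C: "C > 0" "\<And>m j. norm (durfee_term q m j) \<le> C * norm q ^ (j * j + m * j)"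
    using durfee_term_bound [OF assms] by metis
  have "norm q ^ (j * j + m * j) \<le> norm q ^ j" for m j
    using assms by (intro power_decreasing) (auto intro: trans_le_add1)
  then have "norm (durfee_term q m j) \<le> C * norm q ^ j" for m j
    using C by (meson less_imp_le mult_left_mono order_trans)
  with C(1) show ?thesis by (intro that) auto
qed

lemma durfee_summable_norm:
  assumes "norm q < 1"
  shows "summable (\<lambda>j. norm (durfee_term q m j))"
proof -
  obtain C where C: "C > 0" "\<And>m j. norm (durfee_term q m j) \<le> C * norm q ^ j"
    using durfee_term_bound' [OF assms] by metis
  show ?thesis
    by (rule summable_comparison_test' [where g = "\<lambda>j. C * norm q ^ j"])
       (use assms C in \<open>auto intro!: summable_mult summable_geometric\<close>)
qed

lemmas durfee_summable = summable_norm_cancel [OF durfee_summable_norm]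

text \<open>The difference of neighbouring sums is \<open>- (q ^ Suc m)\<close> times the next such
  difference. Since the sums are bounded uniformly in \<open>m\<close>, iterating forces the
  difference to be 0.\<close>

lemma durfee_suminf_Suc:
  assumes q: "norm q < 1"
  shows "suminf (durfee_term q (Suc m)) = suminf (durfee_term q m)"
proof -
  let ?D = "\<lambda>m. suminf (durfee_term q m)"
  have nz: "qpoch q q n \<noteq> 0" for n using qpoch_nonzero q by blast
  have nz': "1 - q * q ^ n \<noteq> 0" for n using nz [of "Suc n"] by (simp add: qpoch_Suc)
  have rec: "?D m - ?D (Suc m) = - (q ^ Suc m * (?D (Suc m) - ?D (Suc (Suc m))))" for m
  proof -
    \<comment> \<open>Over a common denominator the difference of the two terms is
      \<open>a j - b j\<close>. The factor \<open>1 - q ^ j\<close> makes \<open>a 0\<close> vanish,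
      and in \<open>a (Suc j)\<close> it cancels the last factor of
      \<open>qpoch q q (Suc j)\<close>, so the shifted \<open>a\<close> can be compared with
      \<open>b\<close>.\<close>
    define a where "a j = q ^ (j * j + m * j) * (1 - q ^ j) / (qpoch q q j * qpoch q q (Suc (j + m)))" for j
    define b where "b j = q ^ Suc m * durfee_term q (Suc m) j" for j
    have ab: "durfee_term q m j - durfee_term q (Suc m) j = a j - b j" for j
      unfolding durfee_term_def a_def b_def using nz [of j] nz [of "j + m"] nz' [of "j + m"]
      by (simp add: qpoch_Suc divide_simps) (simp add: power_add algebra_simps)
    have sb: "summable b"
      unfolding b_def by (intro summable_mult durfee_summable q)
    have "summable (\<lambda>j. (durfee_term q m j - durfee_term q (Suc m) j) + b j)"
      by (intro summable_add summable_diff durfee_summable q sb)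
    then have sa: "summable a" unfolding ab by simp
    have "?D m - ?D (Suc m) = (\<Sum>j. durfee_term q m j - durfee_term q (Suc m) j)"
      by (intro suminf_diff durfee_summable q)
    also have "\<dots> = suminf a - suminf b"
      unfolding ab by (intro suminf_diff [symmetric] sa sb)
    also have "suminf a = (\<Sum>j. a (Suc j))"
      using suminf_split_head [OF sa] by (simp add: a_def)
    also have "\<dots> - suminf b = (\<Sum>j. a (Suc j) - b j)"
      by (intro suminf_diff sb) (use sa in \<open>simp add: summable_Suc_iff\<close>)
    also have "\<dots> = (\<Sum>j. - (q ^ Suc m * (durfee_term q (Suc m) j - durfee_term q (Suc (Suc m)) j)))"
    proof (rule suminf_cong)
      fix j
      have p: "q ^ (j * j + Suc m * j) = q ^ (j * j + m * j) * q ^ j"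
        "q ^ (j * j + Suc (Suc m) * j) = q ^ (j * j + m * j) * q ^ j * q ^ j"
        "q ^ (Suc j * Suc j + m * Suc j) = q ^ (j * j + m * j) * q ^ j * q ^ j * q * q ^ m"
        by (simp_all add: power_add algebra_simps)
      have "a (Suc j) = q ^ (Suc j * Suc j + m * Suc j) / (qpoch q q j * qpoch q q (Suc (Suc (j + m))))"
        using nz' [of j] by (simp add: a_def qpoch_Suc [of _ _ j])
      then show "a (Suc j) - b j
          = - (q ^ Suc m * (durfee_term q (Suc m) j - durfee_term q (Suc (Suc m)) j))"
        unfolding durfee_term_def b_def p using nz [of j] nz [of "j + m"] nz' [of "j + m"] nz' [of "Suc (j + m)"]
        by (simp add: qpoch_Suc divide_simps) (simp add: power_add algebra_simps)
    qed
    also have "\<dots> = - (q ^ Suc m * (?D (Suc m) - ?D (Suc (Suc m))))"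
      by (subst suminf_minus, intro summable_mult summable_diff durfee_summable q)
         (simp add: suminf_mult suminf_diff summable_diff durfee_summable q)
    finally show ?thesis .
  qed
  obtain C where C: "C > 0" "\<And>m j. norm (durfee_term q m j) \<le> C * norm q ^ j"
    using durfee_term_bound' [OF q] by metis
  define M where "M = (\<Sum>j. C * norm q ^ j)"
  have M: "norm (?D m) \<le> M" for m
    unfolding M_def
    by (rule norm_suminf_le [OF C(2)]) (use q in \<open>auto intro!: summable_mult summable_geometric\<close>)
  \<comment> \<open>Each use of \<open>rec\<close> gains at least one factor \<open>norm q\<close>,
    because its exponent \<open>Suc m\<close> is positive.\<close>
  have "norm (?D m - ?D (Suc m)) \<le> norm q ^ k * (2 * M)" for k
  proof (induction k arbitrary: m)
    case 0
    then show ?case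
      using norm_triangle_ineq4 [of "?D m" "?D (Suc m)"] M [of m] M [of "Suc m"] by simp
  next
    case (Suc k)
    have "norm (?D m - ?D (Suc m)) = norm q ^ Suc m * norm (?D (Suc m) - ?D (Suc (Suc m)))"
      unfolding rec [of m] norm_minus_cancel norm_mult norm_power ..
    also have "\<dots> \<le> norm q ^ 1 * (norm q ^ k * (2 * M))"
      using q by (intro mult_mono power_decreasing Suc) auto
    finally show ?case by simp
  qed
  moreover have "(\<lambda>k. norm q ^ k * (2 * M)) \<longlonglongrightarrow> 0 * (2 * M)"
    using q by (intro tendsto_intros LIMSEQ_power_zero) simp
  ultimately have "norm (?D m - ?D (Suc m)) \<le> 0"
    by (intro LIMSEQ_le_const [where X = "\<lambda>k. norm q ^ k * (2 * M)"]) auto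
  then show ?thesis by simp
qed

text \<open>By \<open>durfee_suminf_Suc\<close> the value is independent of \<open>m\<close>, so it
  can be computed as \<open>m\<close> tends to infinity, where only the term \<open>j = 0\<close>,
  that is \<open>1 / qpoch q q m\<close>, survives.\<close>

lemma durfee_identity:
  assumes q: "norm q < 1"
  shows "durfee_term q m sums inverse (qpoch_inf q q)"
proof -
  let ?D = "\<lambda>m. suminf (durfee_term q m)"
  have const: "?D m = ?D 0" for m
    by (induction m) (simp_all add: durfee_suminf_Suc q)
  obtain C where C: "C > 0" "\<And>m j. norm (durfee_term q m j) \<le> C * norm q ^ (j * j + m * j)"
    using durfee_term_bound [OF q] by metis
  define M where "M = (\<Sum>j. C * norm q ^ j)"
  have sg: "summable (\<lambda>j. C * norm q ^ j)"
    using q by (intro summable_mult summable_geometric) simp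
  have "norm (?D m - inverse (qpoch q q m)) \<le> M * norm q ^ m" for m
  proof -
    have "?D m - inverse (qpoch q q m) = (\<Sum>j. durfee_term q m (Suc j))"
      using suminf_split_head [OF durfee_summable [OF q, of m]]
      by (simp add: durfee_term_def [of q m 0] inverse_eq_divide)
    also have "norm \<dots> \<le> (\<Sum>j. C * norm q ^ j * norm q ^ m)"
    proof (rule norm_suminf_le)
      show "summable (\<lambda>j. C * norm q ^ j * norm q ^ m)" by (intro summable_mult2 sg)
      fix j
      have "norm (durfee_term q m (Suc j)) \<le> C * norm q ^ (Suc j * Suc j + m * Suc j)" by (rule C)
      also have "\<dots> \<le> C * norm q ^ (j + m)"
        using q C(1) by (intro mult_left_mono power_decreasing) auto
      finally show "norm (durfee_term q m (Suc j)) \<le> C * norm q ^ j * norm q ^ m"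
        by (simp add: power_add mult.assoc)
    qed
    also have "\<dots> = M * norm q ^ m"
      unfolding M_def by (rule suminf_mult2 [symmetric, OF sg])
    finally show ?thesis .
  qed
  moreover have "(\<lambda>m. M * norm q ^ m) \<longlonglongrightarrow> M * 0"
    using q by (intro tendsto_intros LIMSEQ_power_zero) simp
  ultimately have "(\<lambda>m. ?D m - inverse (qpoch q q m)) \<longlonglongrightarrow> 0"
    using Lim_null_comparison [of "\<lambda>m. ?D m - inverse (qpoch q q m)" "\<lambda>m. M * norm q ^ m" sequentially]
    by simp
  moreover have "(\<lambda>m. inverse (qpoch q q m)) \<longlonglongrightarrow> inverse (qpoch_inf q q)"
    by (intro tendsto_inverse qpoch_tendsto qpoch_inf_nonzero q)
  ultimately have "(\<lambda>m. ?D m) \<longlonglongrightarrow> inverse (qpoch_inf q q)"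
    using tendsto_add by fastforce
  then have "?D 0 = inverse (qpoch_inf q q)"
    by (subst (asm) const) (simp add: LIMSEQ_const_iff)
  then show ?thesis
    using summable_sums [OF durfee_summable [OF q, of m]] const [of m] by simp
qed

section \<open>Jacobi's triple product\<close>

text \<open>The coefficient of \<open>z ^ l\<close> in Euler's series for
  \<open>qpoch_inf (- z) q\<close> times that of \<open>z powi (- j)\<close> in the series for
  \<open>qpoch_inf (- (q / z)) q\<close>; the extra \<open>q ^ j\<close> of the latter is the
  \<open>+ 1\<close> in \<open>tri (int j + 1)\<close>.\<close>

definition jacobi_term :: "complex \<Rightarrow> nat \<Rightarrow> nat \<Rightarrow> complex" where
  "jacobi_term q l j = q powi (tri (int l) + tri (int j + 1)) / (qpoch q q l * qpoch q q j)"

text \<open>Complex families are summable exactly when they are absolutely summable, which makes the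
  product family summable and justifies iterated summation.\<close>

lemma infsum_times:
  fixes f :: "'a \<Rightarrow> complex" and g :: "'b \<Rightarrow> complex"
  assumes "f summable_on A" "g summable_on B"
  shows "(\<lambda>(x, y). f x * g y) summable_on A \<times> B"
    "(\<Sum>\<^sub>\<infinity>(x, y)\<in>A \<times> B. f x * g y) = infsum f A * infsum g B"
proof -
  have "(\<lambda>x. norm (f x)) summable_on A" "(\<lambda>y. norm (g y)) summable_on B"
    using assms by (simp_all add: summable_on_iff_abs_summable_on_complex)
  then have "(\<lambda>z. norm (case z of (x, y) \<Rightarrow> f x * g y)) summable_on A \<times> B"
    by (subst Infinite_Sum.abs_summable_on_Sigma_iff)
       (auto simp: norm_mult infsum_cmult_right' summable_on_cmult_right
         infsum_nonneg abs_mult intro!: summable_on_cmult_left)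
  then show *: "(\<lambda>(x, y). f x * g y) summable_on A \<times> B"
    by (rule abs_summable_summable)
  from infsum_Sigma'_banach [OF *]
  show "(\<Sum>\<^sub>\<infinity>(x, y)\<in>A \<times> B. f x * g y) = infsum f A * infsum g B"
    by (simp add: infsum_cmult_right' infsum_cmult_left')
qed

lemma euler_has_sum:
  assumes "norm q < 1" "q \<noteq> 0"
  shows "((\<lambda>n. q powi tri (int n) * z ^ n / qpoch q q n) has_sum qpoch_inf (- z) q) UNIV"
  using euler_summable euler_identity assms by (intro norm_summable_imp_has_sum)

lemma jacobi_term_eq:
  assumes "q \<noteq> 0" "z \<noteq> 0"
  shows "jacobi_term q l j * z powi (int l - int j)
    = (q powi tri (int l) * z ^ l / qpoch q q l) * (q powi tri (int j) * (q / z) ^ j / qpoch q q j)"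
proof -
  have "tri (int j + 1) = tri (int j) + int j"
    using tri_add [of "int j" 1] by simp
  then show ?thesis
    using assms by (simp add: jacobi_term_def power_int_add power_int_diff power_divide mult_ac)
qed

lemma jacobi_term_has_sum:
  assumes q: "norm q < 1" "q \<noteq> 0" and z: "z \<noteq> 0"
  shows "((\<lambda>(l, j). jacobi_term q l j * z powi (int l - int j))
    has_sum qpoch_inf (- z) q * qpoch_inf (- (q / z)) q) UNIV"
proof -
  note E = euler_has_sum [OF q, THEN has_sum_imp_summable]
  show ?thesis
    using infsum_times [OF E [of z] E [of "q / z"]]
      infsumI [OF euler_has_sum [OF q, of z]] infsumI [OF euler_has_sum [OF q, of "q / z"]]
    by (simp add: jacobi_term_eq [OF q(2) z] has_sum_iff)
qed

text \<open>The product at \<open>z = 1\<close> gives absolute summability of the bare terms, which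
  survives any bounded weight.\<close>

lemma jacobi_term_summable:
  assumes q: "norm q < 1" "q \<noteq> 0" and w: "\<And>l j. norm (w l j) \<le> B"
  shows "(\<lambda>(l, j). jacobi_term q l j * w l j) summable_on UNIV"
proof -
  have "(\<lambda>(l, j). jacobi_term q l j) summable_on UNIV"
    using jacobi_term_has_sum [OF q, of 1] by (simp add: has_sum_iff)
  then have "(\<lambda>(l, j). norm (jacobi_term q l j)) summable_on UNIV"
    by (subst (asm) summable_on_iff_abs_summable_on_complex) (simp add: case_prod_unfold)
  then have "(\<lambda>p. (case p of (l, j) \<Rightarrow> norm (jacobi_term q l j)) * B) summable_on UNIV"
    by (rule summable_on_cmult_left)
  then have "(\<lambda>p. norm (case p of (l, j) \<Rightarrow> jacobi_term q l j * w l j)) summable_on UNIV"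
    by (rule Infinite_Sum.abs_summable_on_comparison_test') (auto simp: norm_mult w mult_left_mono)
  then show ?thesis by (rule abs_summable_summable)
qed

text \<open>By Durfee's identity the coefficient of \<open>z\<^sup>m\<close> in the product of the two Euler series is
  \<open>q\<^bsup>m(m-1)/2\<^esup> / (q; q)\<^sub>\<infinity>\<close>; hence \<open>z\<^sup>m\<close> can be replaced by any weight \<open>w m\<close>.\<close>
lemma jacobi_transform:
  assumes q: "norm q < 1" "q \<noteq> 0"
    and summ: "(\<lambda>(l, j). jacobi_term q l j * w (int l - int j)) summable_on UNIV"
  shows "(\<Sum>\<^sub>\<infinity>(l, j). jacobi_term q l j * w (int l - int j))
    = (\<Sum>\<^sub>\<infinity>m. q powi tri m * w m) / qpoch_inf q q"
proof -
  let ?f = "\<lambda>(l, j). jacobi_term q l j * w (int l - int j)"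
  \<comment> \<open>Pairs are indexed by their difference \<open>m\<close> and their minimum
    \<open>k\<close>. For fixed \<open>m\<close> the sum over \<open>k\<close> becomes a Durfee sum
    with parameter \<open>nat \<bar>m\<bar>\<close>.\<close>
  let ?g = "\<lambda>(m, k). (k + nat m, k + nat (- m))"
  have bij: "bij_betw ?g (UNIV \<times> UNIV) (UNIV :: (nat \<times> nat) set)"
    by (rule bij_betwI [where g = "\<lambda>(l, j). (int l - int j, min l j)"]) (auto split: prod.splits)
  have inner: "?f (?g (m, k)) = durfee_term q (nat \<bar>m\<bar>) k * (q powi tri m * w m)" for m k
  proof -
    have *: "q powi (tri (int k + int p) + tri (int k + 1)) = q ^ (k * k + p * k) * q powi tri (int p)"
      "q powi (tri (int k) + tri (int k + int p + 1)) = q ^ (k * k + p * k) * q powi tri (- int p)" for p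
    proof -
      have "2 * (tri (int k + int p) + tri (int k + 1)) = 2 * (int (k * k + p * k) + tri (int p))"
        "2 * (tri (int k) + tri (int k + int p + 1)) = 2 * (int (k * k + p * k) + tri (- int p))"
        unfolding distrib_left two_tri by (simp_all add: algebra_simps)
      then have **: "tri (int k + int p) + tri (int k + 1) = int (k * k + p * k) + tri (int p)"
        "tri (int k) + tri (int k + int p + 1) = int (k * k + p * k) + tri (- int p)" by simp_all
      show "q powi (tri (int k + int p) + tri (int k + 1)) = q ^ (k * k + p * k) * q powi tri (int p)"
        "q powi (tri (int k) + tri (int k + int p + 1)) = q ^ (k * k + p * k) * q powi tri (- int p)"
        unfolding ** using q by (simp_all only: power_int_add power_int_of_nat simp_thms)
    qed
    show ?thesis
    proof (cases m rule: int_cases2)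
      case (nonneg p)
      then show ?thesis by (simp add: jacobi_term_def durfee_term_def * mult_ac)
    next
      case (nonpos p)
      then show ?thesis by (simp add: jacobi_term_def durfee_term_def * mult_ac)
    qed
  qed
  have "(\<lambda>p. ?f (?g p)) summable_on UNIV \<times> UNIV"
    using summable_on_reindex_bij_betw [OF bij, of ?f] summ by simp
  then have "(\<Sum>\<^sub>\<infinity>p\<in>UNIV \<times> UNIV. ?f (?g p)) = (\<Sum>\<^sub>\<infinity>m. \<Sum>\<^sub>\<infinity>k. ?f (?g (m, k)))"
    by (rule infsum_Sigma_banach [symmetric])
  also have "\<dots> = (\<Sum>\<^sub>\<infinity>m. inverse (qpoch_inf q q) * (q powi tri m * w m))"
  proof (rule infsum_cong)
    fix m
    have "(durfee_term q (nat \<bar>m\<bar>) has_sum inverse (qpoch_inf q q)) UNIV"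
      by (intro norm_summable_imp_has_sum durfee_summable_norm durfee_identity q)
    then show "(\<Sum>\<^sub>\<infinity>k. ?f (?g (m, k))) = inverse (qpoch_inf q q) * (q powi tri m * w m)"
      unfolding inner infsum_cmult_left' by (simp add: infsumI)
  qed
  also have "\<dots> = (\<Sum>\<^sub>\<infinity>m. q powi tri m * w m) / qpoch_inf q q"
    by (simp add: infsum_cmult_right' divide_inverse mult.commute)
  finally show ?thesis
    using infsum_reindex_bij_betw [OF bij, of ?f] by simp
qed

text \<open>With the weight \<open>z powi m\<close>, the double sum in
  \<open>jacobi_transform\<close> is the product of Euler's two series.\<close>

theorem jacobi_triple_product:
  assumes q: "norm q < 1" "q \<noteq> 0" and z: "z \<noteq> 0"
  shows "(\<Sum>\<^sub>\<infinity>m. q powi tri m * z powi m)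
    = qpoch_inf (- z) q * qpoch_inf (- (q / z)) q * qpoch_inf q q"
proof -
  note J = jacobi_term_has_sum [OF q z]
  from jacobi_transform [OF q has_sum_imp_summable [OF J]] infsumI [OF J] show ?thesis
    using qpoch_inf_nonzero [OF q(1) q(1)] by (simp add: field_simps)
qed

section \<open>The Rogers--Ramanujan identities\<close>

text \<open>For \<open>N = 2 s\<close> this is the Bailey sum of \<open>(-1)\<^bsup>r\<^esup> q\<^bsup>r(3r+1)/2\<^esup> / ((q; q)\<^bsub>s-r\<^esub> (q; q)\<^bsub>s+r\<^esub>)\<close>
  over \<open>-s \<le> r \<le> s\<close>; for \<open>N = 2 s + 1\<close> the second factor is \<open>(q; q)\<^bsub>s+r+1\<^esub>\<close> and \<open>r \<ge> -s-1\<close>.\<close>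
definition rr_sum :: "complex \<Rightarrow> nat \<Rightarrow> complex" where
  "rr_sum q N = (\<Sum>l\<le>N. let r = int (N div 2) - int l in
     (- 1) powi r * q powi (r\<^sup>2 + tri (r + 1)) / (qpoch q q l * qpoch q q (N - l)))"

text \<open>For the first equation split off \<open>1 - q\<^bsup>s+r+1\<^esup>\<close>; the remaining sum is antisymmetric under
  \<open>r \<mapsto> -1-r\<close>. For the second one split off \<open>1 - q\<^bsup>s+1-r\<^esup>\<close> and reflect \<open>r \<mapsto> -r\<close>.\<close>
lemma rr_sum_eq:
  assumes q: "norm q < 1" "q \<noteq> 0"
  shows "rr_sum q (2 * s + 1) = rr_sum q (2 * s)"
    "rr_sum q (2 * s + 1) = (1 - q ^ Suc s) * rr_sum q (2 * s + 2)"
proof -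
  have nz: "qpoch q q n \<noteq> 0" for n using qpoch_nonzero q by blast
  have nz': "1 - q * q ^ n \<noteq> 0" for n using nz [of "Suc n"] by (simp add: qpoch_Suc)
  \<comment> \<open>The exponent is left free, since splitting off a denominator factor produces a
    second exponent.\<close>
  define t where "t N e = (\<Sum>l\<le>N. let r = int (N div 2) - int l in
     (- 1) powi r * q powi e r / (qpoch q q l * qpoch q q (N - l)))" for N and e :: "int \<Rightarrow> int"
  have rr_t: "rr_sum q N = t N (\<lambda>r. r\<^sup>2 + tri (r + 1))" for N
    by (simp add: rr_sum_def t_def)
  have pm: "(- 1 :: complex) powi (- 1 - r) = - ((- 1) powi r)" "(- 1 :: complex) powi (- r) = (- 1) powi r"
    for r by (auto simp: power_int_minus_left)
  have "t (2 * s + 1) (\<lambda>r. 3 * tri (r + 1)) = - t (2 * s + 1) (\<lambda>r. 3 * tri (r + 1))"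
    unfolding t_def sum_negf [symmetric] Let_def
  proof (rule sum.reindex_bij_witness [where i = "\<lambda>l. 2 * s + 1 - l" and j = "\<lambda>l. 2 * s + 1 - l"])
    fix l assume "l \<in> {..2 * s + 1}"
    then have r: "int ((2 * s + 1) div 2) - int (2 * s + 1 - l) = - 1 - (int ((2 * s + 1) div 2) - int l)"
      and l: "2 * s + 1 - (2 * s + 1 - l) = l" by auto
    have "tri (- 1 - (int ((2 * s + 1) div 2) - int l) + 1) = tri (int ((2 * s + 1) div 2) - int l + 1)"
      using tri_one_minus [of "int ((2 * s + 1) div 2) - int l + 1"] by (simp add: algebra_simps)
    then show "- ((- 1) powi (int ((2 * s + 1) div 2) - int (2 * s + 1 - l)) *
        q powi (3 * tri (int ((2 * s + 1) div 2) - int (2 * s + 1 - l) + 1)) /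
        (qpoch q q (2 * s + 1 - l) * qpoch q q (2 * s + 1 - (2 * s + 1 - l)))) =
        (- 1) powi (int ((2 * s + 1) div 2) - int l) *
        q powi (3 * tri (int ((2 * s + 1) div 2) - int l + 1)) / (qpoch q q l * qpoch q q (2 * s + 1 - l))"
      unfolding r l pm by (simp add: mult.commute)
  qed auto
  then have zero: "t (2 * s + 1) (\<lambda>r. 3 * tri (r + 1)) = 0"
    by simp
  \<comment> \<open>The range may be extended by one index: the new factor
    \<open>1 - q ^ (2 * s + 1 - l)\<close> vanishes at \<open>l = 2 * s + 1\<close>.\<close>
  have "rr_sum q (2 * s) = (\<Sum>l\<le>2 * s + 1. let r = int s - int l in
     (- 1) powi r * q powi (r\<^sup>2 + tri (r + 1)) * (1 - q ^ (2 * s + 1 - l)) / (qpoch q q l * qpoch q q (2 * s + 1 - l)))"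
    unfolding rr_sum_def Let_def
    by (simp, intro sum.cong refl)
       (use nz nz' in \<open>auto simp: Suc_diff_le qpoch_Suc\<close>)
  also have "\<dots> = (\<Sum>l\<le>2 * s + 1. (let r = int s - int l in
     (- 1) powi r * q powi (r\<^sup>2 + tri (r + 1)) / (qpoch q q l * qpoch q q (2 * s + 1 - l)))
     - q ^ Suc s * (let r = int s - int l in
     (- 1) powi r * q powi (3 * tri (r + 1)) / (qpoch q q l * qpoch q q (2 * s + 1 - l))))"
  proof (rule sum.cong [OF refl])
    fix l assume l: "l \<in> {..2 * s + 1}"
    define r where "r = int s - int l"
    have "r\<^sup>2 + tri (r + 1) + (int s + r + 1) = int (Suc s) + 3 * tri (r + 1)"
      using two_tri [of "r + 1"] by (simp add: power2_eq_square algebra_simps)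
    moreover have "int (2 * s + 1 - l) = int s + r + 1" using l by (simp add: r_def)
    ultimately have "q powi (r\<^sup>2 + tri (r + 1)) * q powi int (2 * s + 1 - l) = q powi int (Suc s) * q powi (3 * tri (r + 1))"
      using q by (simp only: power_int_add [symmetric] simp_thms)
    then have e: "q powi (r\<^sup>2 + tri (r + 1)) * q ^ (2 * s + 1 - l) = q ^ Suc s * q powi (3 * tri (r + 1))"
      by (simp only: power_int_of_nat)
    have "(- 1) powi r * q powi (r\<^sup>2 + tri (r + 1)) * (1 - q ^ (2 * s + 1 - l))
      = (- 1) powi r * q powi (r\<^sup>2 + tri (r + 1)) - (- 1) powi r * (q powi (r\<^sup>2 + tri (r + 1)) * q ^ (2 * s + 1 - l))"
      by (simp add: algebra_simps)
    then show "(let r = int s - int l in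
     (- 1) powi r * q powi (r\<^sup>2 + tri (r + 1)) * (1 - q ^ (2 * s + 1 - l)) / (qpoch q q l * qpoch q q (2 * s + 1 - l)))
     = (let r = int s - int l in
     (- 1) powi r * q powi (r\<^sup>2 + tri (r + 1)) / (qpoch q q l * qpoch q q (2 * s + 1 - l)))
     - q ^ Suc s * (let r = int s - int l in
     (- 1) powi r * q powi (3 * tri (r + 1)) / (qpoch q q l * qpoch q q (2 * s + 1 - l)))"
      unfolding Let_def r_def [symmetric] e by (simp add: diff_divide_distrib mult_ac)
  qed
  also have "\<dots> = rr_sum q (2 * s + 1) - q ^ Suc s * t (2 * s + 1) (\<lambda>r. 3 * tri (r + 1))"
    by (simp add: rr_sum_def t_def sum_subtractf sum_distrib_left del: sum.atMost_Suc)
  finally show "rr_sum q (2 * s + 1) = rr_sum q (2 * s)"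
    using zero by simp

  have "t (2 * s + 2) (\<lambda>r. r\<^sup>2 + tri r) = t (2 * s + 2) (\<lambda>r. r\<^sup>2 + tri (r + 1))"
    unfolding t_def Let_def
  proof (rule sum.reindex_bij_witness [where i = "\<lambda>l. 2 * s + 2 - l" and j = "\<lambda>l. 2 * s + 2 - l"])
    fix l assume "l \<in> {..2 * s + 2}"
    then have r: "int ((2 * s + 2) div 2) - int (2 * s + 2 - l) = - (int ((2 * s + 2) div 2) - int l)"
      and l: "2 * s + 2 - (2 * s + 2 - l) = l" by auto
    have "tri (- (int ((2 * s + 2) div 2) - int l) + 1) = tri (int ((2 * s + 2) div 2) - int l)"
      using tri_one_minus [of "int ((2 * s + 2) div 2) - int l"] by (simp add: algebra_simps)
    then show "(- 1) powi (int ((2 * s + 2) div 2) - int (2 * s + 2 - l)) *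
        q powi ((int ((2 * s + 2) div 2) - int (2 * s + 2 - l))\<^sup>2 + tri (int ((2 * s + 2) div 2) - int (2 * s + 2 - l) + 1)) /
        (qpoch q q (2 * s + 2 - l) * qpoch q q (2 * s + 2 - (2 * s + 2 - l))) =
        (- 1) powi (int ((2 * s + 2) div 2) - int l) *
        q powi ((int ((2 * s + 2) div 2) - int l)\<^sup>2 + tri (int ((2 * s + 2) div 2) - int l)) / (qpoch q q l * qpoch q q (2 * s + 2 - l))"
      unfolding r l pm power2_minus by (simp add: mult.commute)
  qed auto
  then have sym: "t (2 * s + 2) (\<lambda>r. r\<^sup>2 + tri r) = rr_sum q (2 * s + 2)"
    by (simp add: rr_t)
  \<comment> \<open>Here the range grows at the lower end: \<open>l\<close> is shifted by one, and
    \<open>1 - q ^ l\<close> vanishes at the new index 0.\<close>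
  have "rr_sum q (2 * s + 1) = (\<Sum>l\<le>2 * s + 2. let r = int (Suc s) - int l in
     (- 1) powi r * q powi (r\<^sup>2 + tri (r + 1)) * (1 - q ^ l) / (qpoch q q l * qpoch q q (2 * s + 2 - l)))"
  proof -
    have *: "2 * s + 2 = Suc (2 * s + 1)" by simp
    show ?thesis
      unfolding rr_sum_def Let_def * sum.atMost_Suc_shift
      using nz' by (simp add: qpoch_Suc del: sum.atMost_Suc)
  qed
  also have "\<dots> = (\<Sum>l\<le>2 * s + 2. (let r = int (Suc s) - int l in
     (- 1) powi r * q powi (r\<^sup>2 + tri (r + 1)) / (qpoch q q l * qpoch q q (2 * s + 2 - l)))
     - q ^ Suc s * (let r = int (Suc s) - int l in
     (- 1) powi r * q powi (r\<^sup>2 + tri r) / (qpoch q q l * qpoch q q (2 * s + 2 - l))))"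
  proof (rule sum.cong [OF refl])
    fix l assume l: "l \<in> {..2 * s + 2}"
    define r where "r = int (Suc s) - int l"
    have "r\<^sup>2 + tri (r + 1) + int l = int (Suc s) + (r\<^sup>2 + tri r)"
      using tri_add [of r 1] by (simp add: r_def)
    then have "q powi (r\<^sup>2 + tri (r + 1)) * q powi int l = q powi int (Suc s) * q powi (r\<^sup>2 + tri r)"
      using q by (simp only: power_int_add [symmetric] simp_thms)
    then have e: "q powi (r\<^sup>2 + tri (r + 1)) * q ^ l = q ^ Suc s * q powi (r\<^sup>2 + tri r)"
      by (simp only: power_int_of_nat)
    have "(- 1) powi r * q powi (r\<^sup>2 + tri (r + 1)) * (1 - q ^ l)
      = (- 1) powi r * q powi (r\<^sup>2 + tri (r + 1)) - (- 1) powi r * (q powi (r\<^sup>2 + tri (r + 1)) * q ^ l)"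
      by (simp add: algebra_simps)
    then show "(let r = int (Suc s) - int l in
     (- 1) powi r * q powi (r\<^sup>2 + tri (r + 1)) * (1 - q ^ l) / (qpoch q q l * qpoch q q (2 * s + 2 - l)))
     = (let r = int (Suc s) - int l in
     (- 1) powi r * q powi (r\<^sup>2 + tri (r + 1)) / (qpoch q q l * qpoch q q (2 * s + 2 - l)))
     - q ^ Suc s * (let r = int (Suc s) - int l in
     (- 1) powi r * q powi (r\<^sup>2 + tri r) / (qpoch q q l * qpoch q q (2 * s + 2 - l)))"
      unfolding Let_def r_def [symmetric] e by (simp add: diff_divide_distrib mult_ac)
  qed
  also have "\<dots> = rr_sum q (2 * s + 2) - q ^ Suc s * t (2 * s + 2) (\<lambda>r. r\<^sup>2 + tri r)"
    by (simp add: rr_sum_def t_def sum_subtractf sum_distrib_left del: sum.atMost_Suc)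
  finally show "rr_sum q (2 * s + 1) = (1 - q ^ Suc s) * rr_sum q (2 * s + 2)"
    unfolding sym by (simp add: algebra_simps)
qed

text \<open>The two recurrences of \<open>rr_sum_eq\<close> are climbed alternately from
  \<open>rr_sum q 0 = 1\<close>.\<close>

lemma rr_sum_value:
  assumes q: "norm q < 1" "q \<noteq> 0"
  shows "rr_sum q N = 1 / qpoch q q (N div 2)"
proof -
  have even: "rr_sum q (2 * s) = 1 / qpoch q q s" for s
  proof (induction s)
    case (Suc s)
    have "1 - q ^ Suc s \<noteq> 0"
      using qpoch_nonzero [OF q(1) q(1), of "Suc s"] by (simp add: qpoch_Suc)
    then have "rr_sum q (2 * s + 2) = rr_sum q (2 * s + 1) / (1 - q ^ Suc s)"
      unfolding rr_sum_eq(2) [OF q] by simp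
    then show ?case
      using rr_sum_eq(1) [OF q, of s] Suc by (simp add: qpoch_Suc)
  qed (simp add: rr_sum_def)
  show ?thesis
  proof (cases "even N")
    case True
    then show ?thesis using even by auto
  next
    case False
    then obtain s where "N = 2 * s + 1" by (elim oddE)
    then show ?thesis using even [of s] rr_sum_eq(1) [OF q, of s] by simp
  qed
qed

section \<open>Rearranging infinite sums along antidiagonals, by parity, reflection and
  shift\<close>

lemma infsum_antidiagonal:
  fixes f :: "nat \<Rightarrow> nat \<Rightarrow> complex"
  assumes "(\<lambda>(i, j). f i j) summable_on UNIV"
  shows "(\<lambda>n. \<Sum>i\<le>n. f i (n - i)) summable_on UNIV"
    "(\<Sum>\<^sub>\<infinity>(i, j). f i j) = (\<Sum>\<^sub>\<infinity>n. \<Sum>i\<le>n. f i (n - i))"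
proof -
  have bij: "bij_betw (\<lambda>(n, i). (i, n - i)) (Sigma UNIV (\<lambda>n::nat. {..n})) UNIV"
    by (rule bij_betwI [where g = "\<lambda>(i, j). (i + j, i)"]) auto
  have *: "(\<lambda>(n, i). f i (n - i)) summable_on Sigma UNIV (\<lambda>n. {..n})"
    using assms summable_on_reindex_bij_betw [OF bij, of "\<lambda>(i, j). f i j"]
    by (simp add: case_prod_unfold)
  show "(\<lambda>n. \<Sum>i\<le>n. f i (n - i)) summable_on UNIV"
    using summable_on_Sigma_banach [OF *] by simp
  show "(\<Sum>\<^sub>\<infinity>(i, j). f i j) = (\<Sum>\<^sub>\<infinity>n. \<Sum>i\<le>n. f i (n - i))"
    using infsum_Sigma'_banach [OF *] infsum_reindex_bij_betw [OF bij, of "\<lambda>(i, j). f i j"]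
    by (simp add: case_prod_unfold)
qed

lemma infsum_two_ranges:
  fixes f :: "'a \<Rightarrow> complex"
  assumes "f summable_on UNIV" "inj g" "inj h" "range g \<inter> range h = {}" "range g \<union> range h = UNIV"
  shows "(\<Sum>\<^sub>\<infinity>n. f n) = (\<Sum>\<^sub>\<infinity>n. f (g n)) + (\<Sum>\<^sub>\<infinity>n. f (h n))"
proof -
  have "infsum f (range g \<union> range h) = infsum f (range g) + infsum f (range h)"
    using assms(1,4) by (intro infsum_Un_disjoint) (auto intro: summable_on_subset_banach)
  then show ?thesis
    using assms by (simp add: infsum_reindex o_def)
qed

lemma infsum_nat_parity:
  fixes f :: "nat \<Rightarrow> complex"
  assumes "f summable_on UNIV"
  shows "(\<Sum>\<^sub>\<infinity>n. f n) = (\<Sum>\<^sub>\<infinity>n. f (2 * n)) + (\<Sum>\<^sub>\<infinity>n. f (2 * n + 1))"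
proof (rule infsum_two_ranges [OF assms])
  show "range (\<lambda>n::nat. 2 * n) \<inter> range (\<lambda>n. 2 * n + 1) = {}"
    by auto presburger
  show "range (\<lambda>n::nat. 2 * n) \<union> range (\<lambda>n. 2 * n + 1) = UNIV"
    by (auto simp: image_def) presburger
qed (auto simp: inj_def)

lemma infsum_int_parity:
  fixes f :: "int \<Rightarrow> complex"
  assumes "f summable_on UNIV"
  shows "(\<Sum>\<^sub>\<infinity>n. f n) = (\<Sum>\<^sub>\<infinity>n. f (2 * n)) + (\<Sum>\<^sub>\<infinity>n. f (2 * n + 1))"
proof (rule infsum_two_ranges [OF assms])
  show "range (\<lambda>n::int. 2 * n) \<inter> range (\<lambda>n. 2 * n + 1) = {}"
    by auto presburger
  show "range (\<lambda>n::int. 2 * n) \<union> range (\<lambda>n. 2 * n + 1) = UNIV"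
    by (auto simp: image_def) presburger
qed (auto simp: inj_def)

lemma infsum_int_reflect: "(\<Sum>\<^sub>\<infinity>n. f (- n)) = (\<Sum>\<^sub>\<infinity>n::int. f n)"
  by (rule infsum_reindex_bij_witness [where i = uminus and j = uminus]) auto

lemma infsum_int_shift: "(\<Sum>\<^sub>\<infinity>n. f (n + k)) = (\<Sum>\<^sub>\<infinity>n::int. f n)"
  by (rule infsum_reindex_bij_witness [where i = "\<lambda>n. n - k" and j = "\<lambda>n. n + k"]) auto

lemma qpoch_inf_power_split:
  assumes "norm x < 1" "m > 0" "c > 0"
  shows "qpoch_inf (x ^ k) (x ^ m) = (\<Prod>i<c. qpoch_inf (x ^ (k + m * i)) (x ^ (m * c)))"
  by (subst qpoch_inf_split [OF norm_power_less_one [OF assms(1,2)] assms(3)])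
     (simp add: power_add power_mult)

lemma qpoch_inf_split_5:
  assumes "norm q < 1"
  shows "qpoch_inf q q = qpoch_inf q (q ^ 5) * qpoch_inf (q ^ 2) (q ^ 5) * qpoch_inf (q ^ 3) (q ^ 5)
    * qpoch_inf (q ^ 4) (q ^ 5) * qpoch_inf (q ^ 5) (q ^ 5)"
  using qpoch_inf_power_split [OF assms, of 1 5 1]
  by (simp add: lessThan_nat_numeral mult_ac numeral_2_eq_2 [symmetric] del: power_Suc)

lemma powi_nat_power: "(x :: 'a :: field) powi (int n * m) = (x ^ n) powi m"
  by (simp add: power_int_power)

text \<open>The exponent hypothesis is doubled so that \<open>two_tri\<close> turns it into a
  polynomial identity.\<close>

lemma powi_mult_eqI:
  fixes x :: "'a :: field"
  assumes "x \<noteq> 0" "2 * (a + b) = 2 * (c + d)"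
  shows "x powi a * x powi b = x powi c * x powi d"
proof -
  from assms(2) have "a + b = c + d" by (metis mult_cancel_left zero_neq_numeral)
  then show ?thesis using assms(1) by (simp add: power_int_add [symmetric])
qed

text \<open>The weight \<open>w\<close> lives on the even integers \<open>-2 r\<close> and is chosen such that the double sum of
  \<open>jacobi_transform\<close>, restricted to the antidiagonal \<open>l + j = 2 s\<close>, is \<open>q\<^bsup>s\<^sup>2\<^esup>\<close> times \<open>rr_sum q (2 s)\<close>.
  For the second identity it lives on the odd integers.\<close>
theorem rogers_ramanujan_1:
  assumes q: "norm q < 1" "q \<noteq> 0"
  shows "(\<Sum>\<^sub>\<infinity>n. q ^ (n * n) / qpoch q q n) = 1 / (qpoch_inf q (q ^ 5) * qpoch_inf (q ^ 4) (q ^ 5))"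
proof -
  define w where "w m = (if even m then (- 1) powi (m div 2) * q powi tri (- (m div 2)) else 0)" for m
  define J where "J l j = jacobi_term q l j * w (int l - int j)" for l j
  have w_even: "w (2 * (- r)) = (- 1) powi r * q powi tri r" for r
  proof -
    have "2 * (- r) div 2 = - r" by (rule nonzero_mult_div_cancel_left) simp
    then show ?thesis
      by (simp only: w_def power_int_minus_one_minus dvd_triv_left if_True minus_minus)
  qed
  have w_le: "norm (w m) \<le> 1" for m
    using norm_powi_tri_le [OF q(1)] by (simp add: w_def norm_mult norm_power_int)
  have summJ: "(\<lambda>(l, j). J l j) summable_on UNIV"
    unfolding J_def by (rule jacobi_term_summable [OF q w_le])
  have "(\<Sum>\<^sub>\<infinity>(l, j). J l j) = (\<Sum>\<^sub>\<infinity>n. \<Sum>l\<le>n. J l (n - l))"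
    by (rule infsum_antidiagonal [OF summJ])
  also have "\<dots> = (\<Sum>\<^sub>\<infinity>s. \<Sum>l\<le>2 * s. J l (2 * s - l)) + (\<Sum>\<^sub>\<infinity>s. \<Sum>l\<le>2 * s + 1. J l (2 * s + 1 - l))"
    by (rule infsum_nat_parity [OF infsum_antidiagonal(1) [OF summJ]])
  \<comment> \<open>\<open>l - j\<close> has the parity of \<open>l + j\<close>, so the weight
    vanishes on odd antidiagonals.\<close>
  also have "(\<lambda>s. \<Sum>l\<le>2 * s + 1. J l (2 * s + 1 - l)) = (\<lambda>s. 0)"
    by (auto simp: J_def w_def fun_eq_iff of_nat_diff intro!: sum.neutral)
  also have "(\<lambda>s. \<Sum>l\<le>2 * s. J l (2 * s - l)) = (\<lambda>s. q ^ (s * s) / qpoch q q s)"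
  proof
    fix s
    have "(\<Sum>l\<le>2 * s. J l (2 * s - l)) = q ^ (s * s) * rr_sum q (2 * s)"
      unfolding rr_sum_def Let_def sum_distrib_left
    proof (rule sum.cong [OF refl])
      fix l assume l: "l \<in> {..2 * s}"
      define r where "r = int s - int l"
      have m: "int l - int (2 * s - l) = 2 * (- r)" and l': "int l = int s - r"
        and j': "int (2 * s - l) = int s + r"
        using l by (auto simp: r_def)
      have "2 * (tri (int s - r) + tri (int s + r + 1) + tri r) = 2 * (int (s * s) + (r\<^sup>2 + tri (r + 1)))"
        unfolding distrib_left two_tri by (simp add: power2_eq_square algebra_simps)
      then have "q powi (tri (int s - r) + tri (int s + r + 1)) * q powi tri r
          = q ^ (s * s) * q powi (r\<^sup>2 + tri (r + 1))"
        using powi_mult_eqI [OF q(2)] by (metis power_int_of_nat)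
      moreover have "w (2 * (- r)) = (- 1) powi r * q powi tri r"
        by (rule w_even)
      ultimately show "J l (2 * s - l) = q ^ (s * s) * ((- 1) powi (int (2 * s div 2) - int l)
        * q powi ((int (2 * s div 2) - int l)\<^sup>2 + tri (int (2 * s div 2) - int l + 1))
        / (qpoch q q l * qpoch q q (2 * s - l)))"
        unfolding J_def jacobi_term_def m unfolding l' j' by (simp add: r_def mult_ac)
    qed
    then show "(\<Sum>l\<le>2 * s. J l (2 * s - l)) = q ^ (s * s) / qpoch q q s"
      by (simp add: rr_sum_value [OF q])
  qed
  finally have L: "(\<Sum>\<^sub>\<infinity>(l, j). J l j) = (\<Sum>\<^sub>\<infinity>n. q ^ (n * n) / qpoch q q n)"
    by simp
  have summ: "(\<lambda>m. q powi tri m * w m) summable_on UNIV"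
  proof -
    have "(\<lambda>m. norm (q powi tri m)) summable_on UNIV"
      using summable_powi_tri [OF q, of 1] by (subst (asm) summable_on_iff_abs_summable_on_complex) simp
    then have "(\<lambda>m. norm (q powi tri m * w m)) summable_on UNIV"
      by (rule Infinite_Sum.abs_summable_on_comparison_test') (simp add: norm_mult mult_left_le w_le)
    then show ?thesis by (rule abs_summable_summable)
  qed
  have q5: "norm (q ^ 5) < 1" by (rule norm_power_less_one [OF q(1)]) simp
  \<comment> \<open>On the theta side only \<open>m = 2 * (- r)\<close> survives, and the exponents
    combine to \<open>5 * tri r + 3 * r\<close>: a triple product in base
    \<open>q ^ 5\<close>.\<close>
  have "(\<Sum>\<^sub>\<infinity>m. q powi tri m * w m)
      = (\<Sum>\<^sub>\<infinity>m. q powi tri (2 * m) * w (2 * m)) + (\<Sum>\<^sub>\<infinity>m. q powi tri (2 * m + 1) * w (2 * m + 1))"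
    by (rule infsum_int_parity [OF summ])
  also have "\<dots> = (\<Sum>\<^sub>\<infinity>m. q powi tri (2 * m) * w (2 * m))"
    by (simp add: w_def)
  also have "\<dots> = (\<Sum>\<^sub>\<infinity>r. q powi tri (2 * (- r)) * w (2 * (- r)))"
    by (rule infsum_int_reflect [symmetric])
  also have "\<dots> = (\<Sum>\<^sub>\<infinity>r. (q ^ 5) powi tri r * (- (q ^ 3)) powi r)"
  proof (rule infsum_cong)
    fix r :: int
    have "2 * (tri (2 * (- r)) + tri r) = 2 * (int 5 * tri r + int 3 * r)"
      using two_tri [of r] two_tri [of "2 * (- r)"] by (simp add: algebra_simps)
    then have "q powi tri (2 * (- r)) * q powi tri r = q powi (int 5 * tri r) * q powi (int 3 * r)"
      by (rule powi_mult_eqI [OF q(2)])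
    then have "q powi tri (2 * (- r)) * q powi tri r = (q ^ 5) powi tri r * (q ^ 3) powi r"
      unfolding powi_nat_power .
    moreover have "w (2 * (- r)) = (- 1) powi r * q powi tri r"
      by (rule w_even)
    moreover have "(- (q ^ 3)) powi r = (- 1) powi r * (q ^ 3) powi r"
      by (auto simp: power_int_minus_left)
    ultimately show "q powi tri (2 * (- r)) * w (2 * (- r)) = (q ^ 5) powi tri r * (- (q ^ 3)) powi r"
      by (simp add: mult_ac)
  qed
  also have "\<dots> = qpoch_inf (q ^ 3) (q ^ 5) * qpoch_inf (q ^ 2) (q ^ 5) * qpoch_inf (q ^ 5) (q ^ 5)"
  proof -
    have "q ^ 5 / q ^ 3 = q ^ 2" using q by (simp add: field_simps)
    then show ?thesis
      using jacobi_triple_product [OF q5, of "- (q ^ 3)"] q by simp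
  qed
  finally have R: "(\<Sum>\<^sub>\<infinity>m. q powi tri m * w m)
    = qpoch_inf (q ^ 3) (q ^ 5) * qpoch_inf (q ^ 2) (q ^ 5) * qpoch_inf (q ^ 5) (q ^ 5)" .
  \<comment> \<open>Dividing by \<open>qpoch_inf q q\<close> cancels the residue classes 2, 3 and 0
    modulo 5 and leaves 1 and 4.\<close>
  have "qpoch_inf (q ^ k) (q ^ 5) \<noteq> 0" if "k > 0" for k
    by (intro qpoch_inf_nonzero norm_power_less_one q that) simp
  from this[of 1] this[of 2] this[of 3] this[of 4] this[of 5] show ?thesis
    using jacobi_transform [OF q summJ [unfolded J_def]]
    unfolding J_def [symmetric] L R
      qpoch_inf_split_5 [OF q(1)]
    by (simp add: divide_simps)
qed

theorem rogers_ramanujan_2: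
  assumes q: "norm q < 1" "q \<noteq> 0"
  shows "(\<Sum>\<^sub>\<infinity>n. q ^ (n * n + n) / qpoch q q n) = 1 / (qpoch_inf (q ^ 2) (q ^ 5) * qpoch_inf (q ^ 3) (q ^ 5))"
proof -
  \<comment> \<open>The shift by 2 normalises the power on the antidiagonal to
    \<open>q ^ (s * s + s)\<close>. It can make the exponent negative, so the bound for the weight
    is \<open>norm (q powi (- 2))\<close> instead of 1.\<close>
  define w where "w m = (if odd m then (- 1) powi ((m + 1) div 2) * q powi (tri (- ((m + 1) div 2) - 1) - 2) else 0)" for m
  define J where "J l j = jacobi_term q l j * w (int l - int j)" for l j
  have w_odd: "w (2 * (- r) - 1) = (- 1) powi r * q powi (tri (r - 1) - 2)" for r
  proof -
    have "(2 * (- r) - 1 + 1) div 2 = - r" "odd (2 * (- r) - 1)" by simp_all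
    then show ?thesis
      by (simp only: w_def power_int_minus_one_minus if_True minus_minus not_False_eq_True)
  qed
  have w_le: "norm (w m) \<le> norm (q powi (- 2))" for m
  proof -
    have "norm (q powi (tri r + (- 2))) \<le> 1 * norm (q powi (- 2))" for r
      using norm_powi_tri_le [OF q(1), of r] q(2)
      by (subst power_int_add) (auto simp only: norm_mult intro!: mult_right_mono norm_ge_zero)
    then show ?thesis by (simp add: w_def norm_mult norm_power_int)
  qed
  have summJ: "(\<lambda>(l, j). J l j) summable_on UNIV"
    unfolding J_def by (rule jacobi_term_summable [OF q w_le])
  have "(\<Sum>\<^sub>\<infinity>(l, j). J l j) = (\<Sum>\<^sub>\<infinity>n. \<Sum>l\<le>n. J l (n - l))"
    by (rule infsum_antidiagonal [OF summJ])
  also have "\<dots> = (\<Sum>\<^sub>\<infinity>s. \<Sum>l\<le>2 * s. J l (2 * s - l)) + (\<Sum>\<^sub>\<infinity>s. \<Sum>l\<le>2 * s + 1. J l (2 * s + 1 - l))"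
    by (rule infsum_nat_parity [OF infsum_antidiagonal(1) [OF summJ]])
  also have "(\<lambda>s. \<Sum>l\<le>2 * s. J l (2 * s - l)) = (\<lambda>s. 0)"
    by (auto simp: J_def w_def fun_eq_iff of_nat_diff intro!: sum.neutral)
  also have "(\<lambda>s. \<Sum>l\<le>2 * s + 1. J l (2 * s + 1 - l)) = (\<lambda>s. q ^ (s * s + s) / qpoch q q s)"
  proof
    fix s
    have "(\<Sum>l\<le>2 * s + 1. J l (2 * s + 1 - l)) = q ^ (s * s + s) * rr_sum q (2 * s + 1)"
      unfolding rr_sum_def Let_def sum_distrib_left
    proof (rule sum.cong [OF refl])
      fix l assume l: "l \<in> {..2 * s + 1}"
      define r where "r = int s - int l"
      have m: "int l - int (2 * s + 1 - l) = 2 * (- r) - 1" and l': "int l = int s - r"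
        and j': "int (2 * s + 1 - l) = int s + r + 1"
        using l by (auto simp: r_def)
      have "2 * (tri (int s - r) + tri (int s + r + 1 + 1) + (tri (r - 1) - 2))
          = 2 * (int (s * s + s) + (r\<^sup>2 + tri (r + 1)))"
        unfolding distrib_left right_diff_distrib two_tri by (simp add: power2_eq_square algebra_simps)
      then have "q powi (tri (int s - r) + tri (int s + r + 1 + 1)) * q powi (tri (r - 1) - 2)
          = q ^ (s * s + s) * q powi (r\<^sup>2 + tri (r + 1))"
        using powi_mult_eqI [OF q(2)] by (metis power_int_of_nat)
      moreover have "w (2 * (- r) - 1) = (- 1) powi r * q powi (tri (r - 1) - 2)"
        by (rule w_odd)
      ultimately show "J l (2 * s + 1 - l) = q ^ (s * s + s) * ((- 1) powi (int ((2 * s + 1) div 2) - int l)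
        * q powi ((int ((2 * s + 1) div 2) - int l)\<^sup>2 + tri (int ((2 * s + 1) div 2) - int l + 1))
        / (qpoch q q l * qpoch q q (2 * s + 1 - l)))"
        unfolding J_def jacobi_term_def m unfolding l' j' by (simp add: r_def mult_ac)
    qed
    then show "(\<Sum>l\<le>2 * s + 1. J l (2 * s + 1 - l)) = q ^ (s * s + s) / qpoch q q s"
      by (simp add: rr_sum_value [OF q] del: sum.atMost_Suc)
  qed
  finally have L: "(\<Sum>\<^sub>\<infinity>(l, j). J l j) = (\<Sum>\<^sub>\<infinity>n. q ^ (n * n + n) / qpoch q q n)"
    by simp
  have summ: "(\<lambda>m. q powi tri m * w m) summable_on UNIV"
  proof -
    have "(\<lambda>m. norm (q powi tri m)) summable_on UNIV"
      using summable_powi_tri [OF q, of 1] by (subst (asm) summable_on_iff_abs_summable_on_complex) simp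
    then have "(\<lambda>m. norm (q powi tri m) * norm (q powi (- 2))) summable_on UNIV"
      by (rule summable_on_cmult_left)
    then have "(\<lambda>m. norm (q powi tri m * w m)) summable_on UNIV"
      by (rule Infinite_Sum.abs_summable_on_comparison_test') (simp add: norm_mult mult_left_mono w_le del: power_int_minus)
    then show ?thesis by (rule abs_summable_summable)
  qed
  have q5: "norm (q ^ 5) < 1" by (rule norm_power_less_one [OF q(1)]) simp
  have "(\<Sum>\<^sub>\<infinity>m. q powi tri m * w m)
      = (\<Sum>\<^sub>\<infinity>m. q powi tri (2 * m) * w (2 * m)) + (\<Sum>\<^sub>\<infinity>m. q powi tri (2 * m + 1) * w (2 * m + 1))"
    by (rule infsum_int_parity [OF summ])
  also have "\<dots> = (\<Sum>\<^sub>\<infinity>m. q powi tri (2 * m + 1) * w (2 * m + 1))"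
    by (simp add: w_def)
  \<comment> \<open>Shift and reflection rewrite the odd integers as \<open>2 * (- r) - 1\<close>,
    the form needed for \<open>w_odd\<close>.\<close>
  also have "\<dots> = (\<Sum>\<^sub>\<infinity>m. q powi tri (2 * (m + (- 1)) + 1) * w (2 * (m + (- 1)) + 1))"
    by (rule infsum_int_shift [symmetric])
  also have "\<dots> = (\<Sum>\<^sub>\<infinity>r. q powi tri (2 * (- r + (- 1)) + 1) * w (2 * (- r + (- 1)) + 1))"
    by (rule infsum_int_reflect [symmetric])
  also have "\<dots> = (\<Sum>\<^sub>\<infinity>r. (q ^ 5) powi tri r * (- (q ^ 4)) powi r)"
  proof (rule infsum_cong)
    fix r :: int
    have m: "2 * (- r + (- 1)) + 1 = 2 * (- r) - 1" by simp
    have "2 * (tri (2 * (- r) - 1) + (tri (r - 1) - 2)) = 2 * (int 5 * tri r + int 4 * r)"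
      using two_tri [of r] two_tri [of "2 * (- r) - 1"] two_tri [of "r - 1"] by (simp add: algebra_simps)
    then have "q powi tri (2 * (- r) - 1) * q powi (tri (r - 1) - 2) = q powi (int 5 * tri r) * q powi (int 4 * r)"
      by (rule powi_mult_eqI [OF q(2)])
    then have "q powi tri (2 * (- r) - 1) * q powi (tri (r - 1) - 2) = (q ^ 5) powi tri r * (q ^ 4) powi r"
      unfolding powi_nat_power .
    moreover have "w (2 * (- r) - 1) = (- 1) powi r * q powi (tri (r - 1) - 2)"
      by (rule w_odd)
    moreover have "(- (q ^ 4)) powi r = (- 1) powi r * (q ^ 4) powi r"
      by (auto simp: power_int_minus_left)
    ultimately show "q powi tri (2 * (- r + (- 1)) + 1) * w (2 * (- r + (- 1)) + 1)
        = (q ^ 5) powi tri r * (- (q ^ 4)) powi r"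
      unfolding m by (simp add: mult_ac)
  qed
  also have "\<dots> = qpoch_inf (q ^ 4) (q ^ 5) * qpoch_inf q (q ^ 5) * qpoch_inf (q ^ 5) (q ^ 5)"
  proof -
    have "q ^ 5 / q ^ 4 = q" using q by (simp add: eval_nat_numeral)
    then show ?thesis
      using jacobi_triple_product [OF q5, of "- (q ^ 4)"] q by simp
  qed
  finally have R: "(\<Sum>\<^sub>\<infinity>m. q powi tri m * w m)
    = qpoch_inf (q ^ 4) (q ^ 5) * qpoch_inf q (q ^ 5) * qpoch_inf (q ^ 5) (q ^ 5)" .
  have "qpoch_inf (q ^ k) (q ^ 5) \<noteq> 0" if "k > 0" for k
    by (intro qpoch_inf_nonzero norm_power_less_one q that) simp
  from this[of 1] this[of 2] this[of 3] this[of 4] this[of 5] show ?thesis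
    using jacobi_transform [OF q summJ [unfolded J_def]]
    unfolding J_def [symmetric] L R
      qpoch_inf_split_5 [OF q(1)]
    by (simp add: divide_simps)
qed

section \<open>Slater's identities modulo 20\<close>

text \<open>Up to a Pochhammer factor this is a Rogers-Szego polynomial in base
  \<open>y\<^sup>2\<close> at \<open>y\<close>. Multiplying by \<open>y ^ Suc n\<close> and
  reflecting \<open>k\<close> puts a factor \<open>p ^ (Suc n - k)\<close> on each term; writing it
  as 1 minus \<open>1 - p ^ (Suc n - k)\<close> lowers the index and gives
  \<open>h (Suc n) * (1 - y ^ Suc n) = h n\<close>.\<close>

lemma rogers_szego_sum:
  assumes y: "norm y < 1"
  shows "(\<Sum>k\<le>n. y ^ k / (qpoch (y\<^sup>2) (y\<^sup>2) k * qpoch (y\<^sup>2) (y\<^sup>2) (n - k))) = 1 / qpoch y y n"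
proof (induction n)
  case (Suc n)
  define p where "p = y\<^sup>2"
  have "norm p < 1" unfolding p_def using norm_power_less_one [OF y, of 2] by simp
  then have nz: "qpoch p p n \<noteq> 0" for n using qpoch_nonzero by blast
  then have nz': "1 - p * p ^ n \<noteq> 0" for n using nz [of "Suc n"] by (simp add: qpoch_Suc)
  define h where "h n = (\<Sum>k\<le>n. y ^ k / (qpoch p p k * qpoch p p (n - k)))" for n
  have "y ^ Suc n * h (Suc n) = (\<Sum>k\<le>Suc n. y ^ Suc n * (y ^ (Suc n - k) / (qpoch p p k * qpoch p p (Suc n - k))))"
    unfolding h_def sum_distrib_left
    by (rule sum.reindex_bij_witness [where i = "\<lambda>k. Suc n - k" and j = "\<lambda>k. Suc n - k"]) (auto simp: mult_ac)
  also have "\<dots> = (\<Sum>k\<le>Suc n. y ^ k / (qpoch p p k * qpoch p p (Suc n - k))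
      - y ^ k * (1 - p ^ (Suc n - k)) / (qpoch p p k * qpoch p p (Suc n - k)))"
  proof (rule sum.cong [OF refl])
    fix k assume "k \<in> {..Suc n}"
    then have "Suc n + (Suc n - k) = k + 2 * (Suc n - k)" by simp
    then have "y ^ Suc n * y ^ (Suc n - k) = y ^ k * p ^ (Suc n - k)"
      by (simp only: p_def power_mult [symmetric] power_add [symmetric])
    then show "y ^ Suc n * (y ^ (Suc n - k) / (qpoch p p k * qpoch p p (Suc n - k)))
      = y ^ k / (qpoch p p k * qpoch p p (Suc n - k))
      - y ^ k * (1 - p ^ (Suc n - k)) / (qpoch p p k * qpoch p p (Suc n - k))"
      by (simp only: times_divide_eq_right) (simp add: diff_divide_distrib [symmetric] algebra_simps)
  qed
  also have "\<dots> = h (Suc n) - (\<Sum>k\<le>Suc n. y ^ k * (1 - p ^ (Suc n - k)) / (qpoch p p k * qpoch p p (Suc n - k)))"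
    unfolding h_def sum_subtractf ..
  also have "(\<Sum>k\<le>Suc n. y ^ k * (1 - p ^ (Suc n - k)) / (qpoch p p k * qpoch p p (Suc n - k))) = h n"
    unfolding h_def using nz nz' by (simp, intro sum.cong refl) (auto simp: Suc_diff_le qpoch_Suc)
  finally have "h (Suc n) * (1 - y ^ Suc n) = h n" by (simp add: algebra_simps)
  moreover have "1 - y ^ Suc n \<noteq> 0"
    using qpoch_nonzero [OF y y, of "Suc n"] by (simp add: qpoch_Suc)
  ultimately have "h (Suc n) = h n / (1 - y ^ Suc n)" by (simp add: nonzero_eq_divide_eq)
  then show ?case
    using Suc by (simp add: h_def p_def qpoch_Suc del: sum.atMost_Suc)
qed simp

text \<open>Both sides are the sum of \<open>y\<^bsup>(k+m)\<^sup>2 + m + 2ck\<^esup> / ((y\<^sup>2; y\<^sup>2)\<^sub>k (y\<^sup>2; y\<^sup>2)\<^sub>m)\<close> over \<open>k, m\<close>.\<close>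
lemma rogers_base_change:
  assumes y: "norm y < 1" "y \<noteq> 0" and c: "c \<le> 1"
  shows "(\<Sum>\<^sub>\<infinity>k. y ^ (k * k + 2 * c * k) / qpoch (y ^ 4) (y ^ 4) k) * qpoch_inf (- (y\<^sup>2)) (y\<^sup>2)
    = (\<Sum>\<^sub>\<infinity>n. y ^ (n * n + c * n) / qpoch y y n)"
proof -
  define p where "p = y\<^sup>2"
  have p: "norm p < 1" "p \<noteq> 0" unfolding p_def using norm_power_less_one [OF y(1), of 2] y(2) by simp_all
  define f where "f k m = y ^ ((k + m) * (k + m) + m + 2 * c * k) / (qpoch p p k * qpoch p p m)" for k m
  obtain C where C: "C > 0" "\<And>n. norm (inverse (qpoch p p n)) \<le> C"
    using qpoch_inverse_bound [OF p(1) p(1)] by metis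
  have summ: "(\<lambda>(k, m). f k m) summable_on UNIV"
  proof -
    have "(\<lambda>n. norm y ^ n) summable_on UNIV"
      using y by (intro norm_summable_imp_summable_on) (simp add: summable_geometric)
    then have "(\<lambda>n. complex_of_real (norm y ^ n)) summable_on UNIV"
      by (rule summable_on_of_real)
    from infsum_times(1) [OF this this] have "(\<lambda>(k, m). complex_of_real (norm y ^ k * norm y ^ m)) summable_on UNIV"
      by simp
    then have "(\<lambda>(k, m). norm y ^ k * norm y ^ m) summable_on UNIV"
      by (subst (asm) summable_on_iff_abs_summable_on_complex)
         (simp add: case_prod_unfold norm_mult norm_power)
    then have "(\<lambda>z. (C * C) * (case z of (k, m) \<Rightarrow> norm y ^ k * norm y ^ m)) summable_on UNIV"
      by (rule summable_on_cmult_right)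
    then have "(\<lambda>z. norm (case z of (k, m) \<Rightarrow> f k m)) summable_on UNIV"
    proof (rule Infinite_Sum.abs_summable_on_comparison_test', clarify)
      fix k m
      have "norm (f k m) = (norm (inverse (qpoch p p k)) * norm (inverse (qpoch p p m)))
          * norm y ^ ((k + m) * (k + m) + m + 2 * c * k)"
        by (simp add: f_def norm_mult norm_divide norm_power norm_inverse field_simps)
      also have "\<dots> \<le> (C * C) * norm y ^ (k + m)"
      proof -
        have "k + m \<le> (k + m) * (k + m) + m + 2 * c * k"
          using le_square [of "k + m"] by linarith
        then show ?thesis
          using C y by (intro mult_mono power_decreasing mult_nonneg_nonneg)
            (auto intro: order.strict_implies_order)
      qed
      finally show "norm (f k m) \<le> (C * C) * (norm y ^ k * norm y ^ m)"
        by (simp add: power_add)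
    qed
    then show ?thesis by (rule abs_summable_summable)
  qed
  have "(\<Sum>\<^sub>\<infinity>(k, m). f k m) = (\<Sum>\<^sub>\<infinity>k. \<Sum>\<^sub>\<infinity>m. f k m)"
    using infsum_Sigma'_banach [of f UNIV "\<lambda>_. UNIV"] summ by simp
  also have "\<dots> = (\<Sum>\<^sub>\<infinity>k. y ^ (k * k + 2 * c * k) / qpoch (y ^ 4) (y ^ 4) k * qpoch_inf (- p) p)"
  proof (rule infsum_cong)
    fix k
    \<comment> \<open>The sum over \<open>m\<close> is Euler's series at \<open>p ^ Suc k\<close>, a
      tail of \<open>qpoch_inf (- p) p\<close>. The missing factors \<open>qpoch (- p) p k\<close>
      join \<open>qpoch p p k\<close> to form the symbol in base \<open>y ^ 4\<close>.\<close>
    have e: "f k m = y ^ (k * k + 2 * c * k) / qpoch p p k * (p powi tri (int m) * (p ^ Suc k) ^ m / qpoch p p m)" for m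
    proof -
      have "p powi tri (int m) = y powi (2 * tri (int m))"
        unfolding p_def by (simp add: power_int_power)
      also have "\<dots> = y powi (int m * int m - int m)"
        unfolding two_tri by (simp add: algebra_simps)
      finally have "p powi tri (int m) * y powi int (2 * (Suc k * m)) * y powi int (k * k + 2 * c * k)
         = y powi int ((k + m) * (k + m) + m + 2 * c * k)"
        using y by (simp only: power_int_add [symmetric] simp_thms) (simp add: algebra_simps)
      then have "p powi tri (int m) * (p ^ Suc k) ^ m * y ^ (k * k + 2 * c * k) = y ^ ((k + m) * (k + m) + m + 2 * c * k)"
        unfolding power_int_of_nat p_def power_mult [symmetric] by (simp add: mult.assoc)
      then show ?thesis by (simp add: f_def mult_ac)
    qed
    have "(\<Sum>\<^sub>\<infinity>m. f k m) = y ^ (k * k + 2 * c * k) / qpoch p p k * qpoch_inf (- (p ^ Suc k)) p"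
      unfolding e infsum_cmult_right' infsumI [OF euler_has_sum [OF p]] ..
    also have "qpoch_inf (- p) p = qpoch (- p) p k * qpoch_inf (- (p ^ Suc k)) p"
      using qpoch_inf_add [OF p(1), of "- p" k] by simp
    then have "qpoch_inf (- (p ^ Suc k)) p = qpoch_inf (- p) p / qpoch (- p) p k"
      using qpoch_nonzero [OF p(1), of "- p" k] p by (simp add: field_simps)
    also have "y ^ (k * k + 2 * c * k) / qpoch p p k * (qpoch_inf (- p) p / qpoch (- p) p k)
        = y ^ (k * k + 2 * c * k) / (qpoch p p k * qpoch (- p) p k) * qpoch_inf (- p) p"
      by simp
    also have "qpoch p p k * qpoch (- p) p k = qpoch (y ^ 4) (y ^ 4) k"
      unfolding qpoch_minus p_def by simp
    finally show "(\<Sum>\<^sub>\<infinity>m. f k m) = y ^ (k * k + 2 * c * k) / qpoch (y ^ 4) (y ^ 4) k * qpoch_inf (- p) p" .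
  qed
  also have "\<dots> = (\<Sum>\<^sub>\<infinity>k. y ^ (k * k + 2 * c * k) / qpoch (y ^ 4) (y ^ 4) k) * qpoch_inf (- p) p"
    by (rule infsum_cmult_left')
  finally have L: "(\<Sum>\<^sub>\<infinity>(k, m). f k m) = (\<Sum>\<^sub>\<infinity>k. y ^ (k * k + 2 * c * k) / qpoch (y ^ 4) (y ^ 4) k) * qpoch_inf (- p) p" .
  have "(\<Sum>\<^sub>\<infinity>(k, m). f k m) = (\<Sum>\<^sub>\<infinity>n. \<Sum>k\<le>n. f k (n - k))"
    by (rule infsum_antidiagonal [OF summ])
  also have "\<dots> = (\<Sum>\<^sub>\<infinity>n. y ^ (n * n + c * n) / qpoch y y n)"
  proof (rule infsum_cong)
    fix n
    have "(\<Sum>k\<le>n. f k (n - k)) = y ^ (n * n + c * n) * (\<Sum>k\<le>n. y ^ k / (qpoch p p k * qpoch p p (n - k)))"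
    \<comment> \<open>On an antidiagonal the exponent exceeds \<open>n * n + c * n\<close> by
      \<open>n - k\<close> if \<open>c = 0\<close> and by \<open>k\<close> if \<open>c = 1\<close>;
      the first case needs the reflection of \<open>k\<close>.\<close>
    proof (cases "c = 0")
      case True
      have "f k (n - k) = y ^ (n * n + c * n) * (y ^ (n - k) / (qpoch p p (n - k) * qpoch p p (n - (n - k))))"
        if "k \<le> n" for k
      proof -
        have e: "(k + (n - k)) * (k + (n - k)) + (n - k) + 2 * c * k = (n * n + c * n) + (n - k)"
          using that True by simp
        show ?thesis unfolding f_def e power_add using that by (simp add: mult_ac)
      qed
      then show ?thesis
        unfolding sum_distrib_left
        by (intro sum.reindex_bij_witness [where i = "\<lambda>k. n - k" and j = "\<lambda>k. n - k"]) auto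
    next
      case False
      then have c: "c = 1" using c by simp
      have "f k (n - k) = y ^ (n * n + c * n) * (y ^ k / (qpoch p p k * qpoch p p (n - k)))" if "k \<le> n" for k
      proof -
        have "(k + (n - k)) * (k + (n - k)) + (n - k) + 2 * c * k = (n * n + c * n) + k"
          using that c by simp
        then show ?thesis unfolding f_def by (simp add: power_add)
      qed
      then show ?thesis by (simp add: sum_distrib_left)
    qed
    then show "(\<Sum>k\<le>n. f k (n - k)) = y ^ (n * n + c * n) / qpoch y y n"
      unfolding p_def rogers_szego_sum [OF y(1)] by simp
  qed
  finally show ?thesis using L by (simp add: p_def)
qed

section \<open>Theta series and conversion between their product forms\<close>

lemma theta_dissection:
  fixes p z :: complex
  assumes p: "norm p < 1" "p \<noteq> 0" and z: "z \<noteq> 0"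
  shows "(\<Sum>\<^sub>\<infinity>m. p powi tri m * z powi m)
    = (\<Sum>\<^sub>\<infinity>m. (p ^ 4) powi tri m * (p * z\<^sup>2) powi m) + z * (\<Sum>\<^sub>\<infinity>m. (p ^ 4) powi tri m * (p ^ 3 * z\<^sup>2) powi m)"
proof -
  have e: "p powi tri (2 * m) = (p ^ 4) powi tri m * p powi m"
    "p powi tri (2 * m + 1) = (p ^ 4) powi tri m * (p ^ 3) powi m" for m
  proof -
    have tri_2: "tri (2 * m) = int 4 * tri m + m" "tri (2 * m + 1) = int 4 * tri m + int 3 * m"
      using two_tri [of m] by (intro tri_eqI; simp add: algebra_simps)+
    show "p powi tri (2 * m) = (p ^ 4) powi tri m * p powi m"
      "p powi tri (2 * m + 1) = (p ^ 4) powi tri m * (p ^ 3) powi m"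
      unfolding tri_2 power_int_add [OF disjI1 [OF p(2)]] powi_nat_power by simp_all
  qed
  have z2: "z powi (2 * m) = (z\<^sup>2) powi m" for m
    using powi_nat_power [of z 2 m] by simp
  have "(\<Sum>\<^sub>\<infinity>m. p powi tri m * z powi m) = (\<Sum>\<^sub>\<infinity>m. p powi tri (2 * m) * z powi (2 * m))
      + (\<Sum>\<^sub>\<infinity>m. p powi tri (2 * m + 1) * z powi (2 * m + 1))"
    by (rule infsum_int_parity [OF summable_powi_tri [OF p]])
  also have "(\<lambda>m. p powi tri (2 * m) * z powi (2 * m)) = (\<lambda>m. (p ^ 4) powi tri m * (p * z\<^sup>2) powi m)"
    by (simp add: fun_eq_iff e z2 power_int_mult_distrib)
  also have "(\<lambda>m. p powi tri (2 * m + 1) * z powi (2 * m + 1))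
      = (\<lambda>m. z * ((p ^ 4) powi tri m * (p ^ 3 * z\<^sup>2) powi m))"
    using z by (simp add: fun_eq_iff e power_int_add z2 power_int_mult_distrib)
  finally show ?thesis by (simp add: infsum_cmult_right')
qed

lemma jacobi_triple_product_power:
  assumes x: "norm x < 1" "x \<noteq> 0" and "k + l = m" "k > 0" "l > 0"
  shows "(\<Sum>\<^sub>\<infinity>n. (x ^ m) powi tri n * (x ^ k) powi n)
    = qpoch_inf (- (x ^ k)) (x ^ m) * qpoch_inf (- (x ^ l)) (x ^ m) * qpoch_inf (x ^ m) (x ^ m)"
proof -
  have "x ^ m / x ^ k = x ^ l"
    using x \<open>k + l = m\<close> by (simp add: power_add flip: \<open>k + l = m\<close>)
  moreover have "norm (x ^ m) < 1"
    using assms by (intro norm_power_less_one) auto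
  ultimately show ?thesis
    using jacobi_triple_product [of "x ^ m" "x ^ k"] x by simp
qed

lemma qpoch_inf_power_nonzero:
  assumes "norm x < 1" "k > 0" "m > 0"
  shows "qpoch_inf (x ^ k) (x ^ m) \<noteq> 0" "qpoch_inf (- (x ^ k)) (x ^ m) \<noteq> 0"
  by (rule qpoch_inf_nonzero; use assms in \<open>simp add: norm_power power_less_one_iff\<close>)+

text \<open>Products with a minus sign are rewritten through positive powers, so that later
  quotients reduce to cancellation.\<close>

lemma qpoch_inf_power_minus:
  assumes "norm x < 1" "m > 0" "k > 0"
  shows "qpoch_inf (- (x ^ k)) (x ^ m) = qpoch_inf (x ^ (2 * k)) (x ^ (2 * m)) / qpoch_inf (x ^ k) (x ^ m)"
  using qpoch_inf_minus [OF norm_power_less_one [OF assms(1,2)], of "x ^ k"]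
    qpoch_inf_power_nonzero(1) [OF assms(1,3,2)]
  by (simp add: field_simps power_mult [symmetric] mult.commute)

text \<open>Even exponents lose the sign of the base and odd ones keep it, so splitting by parity
  trades a negative base for its square.\<close>

lemma qpoch_inf_minus_base:
  assumes "norm q < 1"
  shows "qpoch_inf a (- q) = qpoch_inf a (q\<^sup>2) * qpoch_inf (- (a * q)) (q\<^sup>2)"
  using qpoch_inf_split [of "- q" 2 a] assms by (simp add: lessThan_nat_numeral numeral_2_eq_2)

text \<open>By \<open>rogers_base_change\<close> and the Rogers-Ramanujan identities the sums are
  products; refined to residues modulo 20, both sides cancel to the same product. The multiplier on
  the left contains only powers of \<open>y ^ 4\<close>, so even and odd parts in \<open>y\<close>
  can be compared afterwards.\<close>

lemma rogers_mod_20_theta: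
  assumes y: "norm y < 1" "y \<noteq> 0"
  shows "(\<Sum>\<^sub>\<infinity>k. y ^ (k * k) / qpoch (y ^ 4) (y ^ 4) k)
      * (qpoch_inf (y ^ 4) (y ^ 20) * qpoch_inf (y ^ 16) (y ^ 20) * qpoch_inf (y ^ 20) (y ^ 20))
    = (\<Sum>\<^sub>\<infinity>m. (y ^ 10) powi tri m * y powi m)"
    "(\<Sum>\<^sub>\<infinity>k. y ^ (k * k + 2 * k) / qpoch (y ^ 4) (y ^ 4) k)
      * (qpoch_inf (y ^ 8) (y ^ 20) * qpoch_inf (y ^ 12) (y ^ 20) * qpoch_inf (y ^ 20) (y ^ 20))
    = (\<Sum>\<^sub>\<infinity>m. (y ^ 10) powi tri m * (y ^ 3) powi m)"
proof -
  note nz = qpoch_inf_power_nonzero [OF y(1)]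
  define E where "E k = qpoch_inf (y ^ k) (y ^ 20)" for k
  have E_nz: "E k \<noteq> 0" if "k > 0" for k unfolding E_def using nz that by simp
  define p where "p k = qpoch_inf (y ^ k) (y ^ 10)" for k
  have p_nz: "p k \<noteq> 0" if "k > 0" for k unfolding p_def using nz that by simp
  have p_E: "p k = E k * E (k + 10)" for k
    unfolding p_def E_def using qpoch_inf_power_split [OF y(1), of 10 2 k]
    by (simp add: lessThan_nat_numeral numeral_2_eq_2 mult_ac)
  have M: "qpoch_inf (- (y ^ k)) (y ^ 10) = E (2 * k) / p k" if "k > 0" for k
    unfolding p_def E_def using qpoch_inf_power_minus [OF y(1) _ that, of 10] by simp
  have s5: "qpoch_inf (y ^ k) (y ^ 5) = p k * p (k + 5)" for k
    unfolding p_def using qpoch_inf_power_split [OF y(1), of 5 2 k]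
    by (simp add: lessThan_nat_numeral numeral_2_eq_2 mult_ac)
  \<comment> \<open>In the quotient of bases \<open>y ^ 4\<close> and \<open>y ^ 2\<close> the
    multiples of 4 cancel; what remains are the exponents 2 modulo 4, listed modulo 20.\<close>
  have W: "qpoch_inf (- (y\<^sup>2)) (y\<^sup>2) = 1 / (E 2 * E 6 * E 10 * E 14 * E 18)"
  proof -
    have "qpoch_inf (y ^ 4) (y ^ 4) = E 4 * E 8 * E 12 * E 16 * E 20"
      unfolding E_def using qpoch_inf_power_split [OF y(1), of 4 5 4]
      by (simp add: lessThan_nat_numeral mult_ac)
    moreover have "qpoch_inf (y ^ 2) (y ^ 2) = E 2 * E 4 * E 6 * E 8 * E 10 * E 12 * E 14 * E 16 * E 18 * E 20"
      unfolding E_def using qpoch_inf_power_split [OF y(1), of 2 10 2]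
      by (simp add: lessThan_nat_numeral mult_ac numeral_2_eq_2 [symmetric] del: power_Suc)
    ultimately show ?thesis
      using qpoch_inf_power_minus [OF y(1), of 2 2] E_nz by simp
  qed
  have "(\<Sum>\<^sub>\<infinity>k. y ^ (k * k) / qpoch (y ^ 4) (y ^ 4) k) * qpoch_inf (- (y\<^sup>2)) (y\<^sup>2)
      = 1 / (p 1 * p 6 * (p 4 * p 9))"
    using rogers_base_change [OF y, of 0] rogers_ramanujan_1 [OF y] s5 [of 1] s5 [of 4] by simp
  then have F: "(\<Sum>\<^sub>\<infinity>k. y ^ (k * k) / qpoch (y ^ 4) (y ^ 4) k)
      = E 2 * E 6 * E 10 * E 14 * E 18 / (p 1 * p 6 * (p 4 * p 9))"
    unfolding W using E_nz p_nz by (simp add: field_simps)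
  have J: "(\<Sum>\<^sub>\<infinity>m. (y ^ 10) powi tri m * y powi m) = E 2 / p 1 * (E 18 / p 9) * p 10"
    using jacobi_triple_product_power [OF y, of 1 9 10] M [of 1] M [of 9] by (simp add: p_def)
  show "(\<Sum>\<^sub>\<infinity>k. y ^ (k * k) / qpoch (y ^ 4) (y ^ 4) k)
      * (qpoch_inf (y ^ 4) (y ^ 20) * qpoch_inf (y ^ 16) (y ^ 20) * qpoch_inf (y ^ 20) (y ^ 20))
    = (\<Sum>\<^sub>\<infinity>m. (y ^ 10) powi tri m * y powi m)"
    unfolding F J E_def [symmetric] p_E [of 4] p_E [of 6] p_E [of 10] using E_nz p_nz
    by (simp add: field_simps)
  have "(\<Sum>\<^sub>\<infinity>k. y ^ (k * k + 2 * k) / qpoch (y ^ 4) (y ^ 4) k) * qpoch_inf (- (y\<^sup>2)) (y\<^sup>2)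
      = 1 / (p 2 * p 7 * (p 3 * p 8))"
    using rogers_base_change [OF y, of 1] rogers_ramanujan_2 [OF y] s5 [of 2] s5 [of 3] by simp
  then have F: "(\<Sum>\<^sub>\<infinity>k. y ^ (k * k + 2 * k) / qpoch (y ^ 4) (y ^ 4) k)
      = E 2 * E 6 * E 10 * E 14 * E 18 / (p 2 * p 7 * (p 3 * p 8))"
    unfolding W using E_nz p_nz by (simp add: field_simps)
  have J: "(\<Sum>\<^sub>\<infinity>m. (y ^ 10) powi tri m * (y ^ 3) powi m) = E 6 / p 3 * (E 14 / p 7) * p 10"
    using jacobi_triple_product_power [OF y, of 3 7 10] M [of 3] M [of 7] by (simp add: p_def)
  show "(\<Sum>\<^sub>\<infinity>k. y ^ (k * k + 2 * k) / qpoch (y ^ 4) (y ^ 4) k)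
      * (qpoch_inf (y ^ 8) (y ^ 20) * qpoch_inf (y ^ 12) (y ^ 20) * qpoch_inf (y ^ 20) (y ^ 20))
    = (\<Sum>\<^sub>\<infinity>m. (y ^ 10) powi tri m * (y ^ 3) powi m)"
    unfolding F J E_def [symmetric] p_E [of 2] p_E [of 8] p_E [of 10] using E_nz p_nz
    by (simp add: field_simps)
qed

text \<open>The exponent is divisible by 4 for even \<open>k\<close> and congruent to
  \<open>2 * c + 1\<close> modulo 4 for odd \<open>k\<close>, so the parity of \<open>k\<close>
  separates even from odd powers of \<open>y\<close>.\<close>

lemma rogers_sum_parity:
  assumes y: "norm y < 1"
  shows "(\<Sum>\<^sub>\<infinity>k. y ^ (k * k + 2 * c * k) / qpoch (y ^ 4) (y ^ 4) k)
    = (\<Sum>\<^sub>\<infinity>k. (y ^ 4) ^ (k * k + c * k) / qpoch (y ^ 4) (y ^ 4) (2 * k))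
    + y ^ (2 * c + 1) * (\<Sum>\<^sub>\<infinity>k. (y ^ 4) ^ (k * k + k + c * k) / qpoch (y ^ 4) (y ^ 4) (2 * k + 1))"
proof -
  define x where "x = y ^ 4"
  have x: "norm x < 1" unfolding x_def by (rule norm_power_less_one [OF y]) simp
  obtain C where C: "C > 0" "\<And>n. norm (inverse (qpoch x x n)) \<le> C"
    using qpoch_inverse_bound [OF x x] by metis
  have "summable (\<lambda>k. norm (y ^ (k * k + 2 * c * k) / qpoch x x k))"
  proof (rule summable_comparison_test')
    show "summable (\<lambda>k. norm y ^ k * C)"
      using y by (intro summable_mult2 summable_geometric) simp
    fix k :: nat
    have "norm y ^ (k * k + 2 * c * k) \<le> norm y ^ k"
      using y by (intro power_decreasing) (auto intro: trans_le_add1)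
    then show "norm (norm (y ^ (k * k + 2 * c * k) / qpoch x x k)) \<le> norm y ^ k * C"
      using mult_mono [OF _ C(2) [of k], of "norm y ^ (k * k + 2 * c * k)" "norm y ^ k"]
      by (simp add: norm_divide norm_power divide_inverse norm_inverse norm_mult)
  qed
  then have "(\<Sum>\<^sub>\<infinity>k. y ^ (k * k + 2 * c * k) / qpoch x x k)
    = (\<Sum>\<^sub>\<infinity>k. y ^ ((2 * k) * (2 * k) + 2 * c * (2 * k)) / qpoch x x (2 * k))
    + (\<Sum>\<^sub>\<infinity>k. y ^ ((2 * k + 1) * (2 * k + 1) + 2 * c * (2 * k + 1)) / qpoch x x (2 * k + 1))"
    by (intro infsum_nat_parity norm_summable_imp_summable_on)
  moreover have "(2 * k) * (2 * k) + 2 * c * (2 * k) = 4 * (k * k + c * k)"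
    "(2 * k + 1) * (2 * k + 1) + 2 * c * (2 * k + 1) = (2 * c + 1) + 4 * (k * k + k + c * k)" for k
    by (simp_all add: algebra_simps)
  ultimately show ?thesis
    unfolding x_def [symmetric]
    by (simp only: power_add power_mult x_def [symmetric] times_divide_eq_right [symmetric] infsum_cmult_right')
qed

lemma even_odd_parts_eqI:
  fixes y :: complex
  assumes "y \<noteq> 0" "a + y * b = c + y * d" "a + (- y) * b = c + (- y) * d"
  shows "a = c" "b = d"
proof -
  have "2 * a = 2 * c" "2 * (y * b) = 2 * (y * d)"
    using assms(2,3) by algebra+
  then show "a = c" "b = d" using assms(1) by simp_all
qed

lemma exists_fourth_root:
  fixes x :: complex
  obtains y where "x = y ^ 4"
proof -
  have "csqrt (csqrt x) ^ 4 = x"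
    using power_mult [of "csqrt (csqrt x)" 2 2] by simp
  then show ?thesis by (intro that [of "csqrt (csqrt x)"]) (rule sym)
qed

text \<open>These are the even and odd parts in \<open>y\<close> of
  \<open>rogers_mod_20_theta(1)\<close> with \<open>x = y ^ 4\<close>, the theta series being split
  by \<open>theta_dissection\<close>.\<close>

lemma slater_theta_1:
  assumes x: "norm x < 1" "x \<noteq> 0"
  shows "(\<Sum>\<^sub>\<infinity>k. x ^ (k * k) / qpoch x x (2 * k))
      * (qpoch_inf x (x ^ 5) * qpoch_inf (x ^ 4) (x ^ 5) * qpoch_inf (x ^ 5) (x ^ 5))
    = qpoch_inf (- (x ^ 3)) (x ^ 10) * qpoch_inf (- (x ^ 7)) (x ^ 10) * qpoch_inf (x ^ 10) (x ^ 10)"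
    "(\<Sum>\<^sub>\<infinity>k. x ^ (k * k + k) / qpoch x x (2 * k + 1))
      * (qpoch_inf x (x ^ 5) * qpoch_inf (x ^ 4) (x ^ 5) * qpoch_inf (x ^ 5) (x ^ 5))
    = qpoch_inf (- (x ^ 8)) (x ^ 10) * qpoch_inf (- (x ^ 2)) (x ^ 10) * qpoch_inf (x ^ 10) (x ^ 10)"
    (is "?B * ?K = ?JB")
proof -
  obtain y where y_x: "x = y ^ 4" using exists_fourth_root by metis
  have y: "norm y < 1" "y \<noteq> 0"
    using x by (auto simp: y_x norm_power power_less_one_iff)
  \<comment> \<open>All coefficients depend only on \<open>x = u ^ 4\<close>, so the equation holds
    at \<open>u = y\<close> and at \<open>u = - y\<close>.\<close>
  have key: "(\<Sum>\<^sub>\<infinity>k. x ^ (k * k) / qpoch x x (2 * k)) * ?K + u * (?B * ?K)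
      = qpoch_inf (- (x ^ 3)) (x ^ 10) * qpoch_inf (- (x ^ 7)) (x ^ 10) * qpoch_inf (x ^ 10) (x ^ 10) + u * ?JB"
    if u: "norm u < 1" "u \<noteq> 0" "u ^ 4 = x" for u
  proof -
    have xp: "x ^ n = u ^ (4 * n)" for n by (simp add: power_mult u)
    have u10: "norm (u ^ 10) < 1" by (rule norm_power_less_one [OF u(1)]) simp
    have p: "(u ^ 10) ^ 4 = x ^ 10" "u ^ 10 * u\<^sup>2 = x ^ 3" "(u ^ 10) ^ 3 * u\<^sup>2 = x ^ 8"
      unfolding xp power_mult [symmetric] power_add [symmetric] by simp_all
    have K: "u ^ 16 = x ^ 4" "u ^ 20 = x ^ 5" by (simp_all add: xp)
    have "(\<Sum>\<^sub>\<infinity>k. u ^ (k * k) / qpoch x x k) = (\<Sum>\<^sub>\<infinity>k. x ^ (k * k) / qpoch x x (2 * k)) + u * ?B"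
      using rogers_sum_parity [OF u(1), of 0] unfolding u(3) by simp
    moreover have "(\<Sum>\<^sub>\<infinity>m. (u ^ 10) powi tri m * u powi m)
        = qpoch_inf (- (x ^ 3)) (x ^ 10) * qpoch_inf (- (x ^ 7)) (x ^ 10) * qpoch_inf (x ^ 10) (x ^ 10) + u * ?JB"
      using theta_dissection [OF u10 _ u(2)]
        jacobi_triple_product_power [OF x, of 3 7 10] jacobi_triple_product_power [OF x, of 8 2 10] u(2)
      unfolding p by simp
    ultimately show ?thesis
      using rogers_mod_20_theta(1) [OF u(1,2)] unfolding K u(3) by (simp only: distrib_right mult.assoc)
  qed
  show "(\<Sum>\<^sub>\<infinity>k. x ^ (k * k) / qpoch x x (2 * k)) * ?K
      = qpoch_inf (- (x ^ 3)) (x ^ 10) * qpoch_inf (- (x ^ 7)) (x ^ 10) * qpoch_inf (x ^ 10) (x ^ 10)"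
    "?B * ?K = ?JB"
    using even_odd_parts_eqI [OF y(2) key key] y y_x by simp_all
qed

lemma slater_theta_2:
  assumes x: "norm x < 1" "x \<noteq> 0"
  shows "(\<Sum>\<^sub>\<infinity>k. x ^ (k * k + k) / qpoch x x (2 * k))
      * (qpoch_inf (x ^ 2) (x ^ 5) * qpoch_inf (x ^ 3) (x ^ 5) * qpoch_inf (x ^ 5) (x ^ 5))
    = qpoch_inf (- (x ^ 4)) (x ^ 10) * qpoch_inf (- (x ^ 6)) (x ^ 10) * qpoch_inf (x ^ 10) (x ^ 10)"
    "(\<Sum>\<^sub>\<infinity>k. x ^ (k * k + 2 * k) / qpoch x x (2 * k + 1))
      * (qpoch_inf (x ^ 2) (x ^ 5) * qpoch_inf (x ^ 3) (x ^ 5) * qpoch_inf (x ^ 5) (x ^ 5))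
    = qpoch_inf (- (x ^ 9)) (x ^ 10) * qpoch_inf (- x) (x ^ 10) * qpoch_inf (x ^ 10) (x ^ 10)"
    (is "?B * ?K = ?JB")
proof -
  obtain y where y_x: "x = y ^ 4" using exists_fourth_root by metis
  have y: "norm y < 1" "y \<noteq> 0"
    using x by (auto simp: y_x norm_power power_less_one_iff)
  have key: "(\<Sum>\<^sub>\<infinity>k. x ^ (k * k + k) / qpoch x x (2 * k)) * ?K + u ^ 3 * (?B * ?K)
      = qpoch_inf (- (x ^ 4)) (x ^ 10) * qpoch_inf (- (x ^ 6)) (x ^ 10) * qpoch_inf (x ^ 10) (x ^ 10) + u ^ 3 * ?JB"
    if u: "norm u < 1" "u \<noteq> 0" "u ^ 4 = x" for u
  proof -
    have xp: "x ^ n = u ^ (4 * n)" for n by (simp add: power_mult u)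
    have u10: "norm (u ^ 10) < 1" by (rule norm_power_less_one [OF u(1)]) simp
    have p: "(u ^ 10) ^ 4 = x ^ 10" "u ^ 10 * (u ^ 3)\<^sup>2 = x ^ 4" "(u ^ 10) ^ 3 * (u ^ 3)\<^sup>2 = x ^ 9"
      unfolding xp power_mult [symmetric] power_add [symmetric] by simp_all
    have K: "u ^ 8 = x ^ 2" "u ^ 12 = x ^ 3" "u ^ 20 = x ^ 5" by (simp_all add: xp)
    have e: "k * k + k + 1 * k = k * k + 2 * k" for k :: nat by simp
    have "(\<Sum>\<^sub>\<infinity>k. u ^ (k * k + 2 * k) / qpoch x x k)
        = (\<Sum>\<^sub>\<infinity>k. x ^ (k * k + k) / qpoch x x (2 * k)) + u ^ 3 * ?B"
      using rogers_sum_parity [OF u(1), of 1] unfolding u(3) e by simp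
    moreover have "(\<Sum>\<^sub>\<infinity>m. (u ^ 10) powi tri m * (u ^ 3) powi m)
        = qpoch_inf (- (x ^ 4)) (x ^ 10) * qpoch_inf (- (x ^ 6)) (x ^ 10) * qpoch_inf (x ^ 10) (x ^ 10) + u ^ 3 * ?JB"
      using theta_dissection [OF u10, of "u ^ 3"]
        jacobi_triple_product_power [OF x, of 4 6 10] jacobi_triple_product_power [OF x, of 9 1 10] u(2)
      unfolding p by simp
    ultimately show ?thesis
      using rogers_mod_20_theta(2) [OF u(1,2)] unfolding K u(3) by (simp only: distrib_right mult.assoc)
  qed
  \<comment> \<open>The odd part now carries \<open>u ^ 3\<close>, which also changes sign with
    \<open>u\<close>; the parts are therefore compared at \<open>y ^ 3\<close>.\<close>
  show "(\<Sum>\<^sub>\<infinity>k. x ^ (k * k + k) / qpoch x x (2 * k)) * ?K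
      = qpoch_inf (- (x ^ 4)) (x ^ 10) * qpoch_inf (- (x ^ 6)) (x ^ 10) * qpoch_inf (x ^ 10) (x ^ 10)"
    "?B * ?K = ?JB"
    using even_odd_parts_eqI [of "y ^ 3", OF _ key] key [of "- y"] y y_x by simp_all
qed

text \<open>The triple products are divided out of the theta identities. With everything refined to
  base \<open>x ^ 10\<close> (\<open>P\<close>) and base \<open>x ^ 20\<close> (\<open>R\<close>),
  this is cancellation of nonzero factors.\<close>

theorem slater_identities:
  assumes x: "norm x < 1" "x \<noteq> 0"
  shows slater_79: "(\<Sum>\<^sub>\<infinity>k. x ^ (k * k) / qpoch x x (2 * k))
      = 1 / (qpoch_inf x (x\<^sup>2) * (qpoch_inf (x ^ 4) (x ^ 20) * qpoch_inf (x ^ 16) (x ^ 20)))"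
    and slater_94: "(\<Sum>\<^sub>\<infinity>k. x ^ (k * k + k) / qpoch x x (2 * k + 1))
      = 1 / (qpoch_inf x (x\<^sup>2) * (qpoch_inf (x\<^sup>2) (- (x ^ 5)) * qpoch_inf (- (x ^ 3)) (- (x ^ 5))))"
    and slater_99: "(\<Sum>\<^sub>\<infinity>k. x ^ (k * k + k) / qpoch x x (2 * k))
      = 1 / (qpoch_inf x (x\<^sup>2) * (qpoch_inf (- x) (- (x ^ 5)) * qpoch_inf (x ^ 4) (- (x ^ 5))))"
    and slater_96: "(\<Sum>\<^sub>\<infinity>k. x ^ (k * k + 2 * k) / qpoch x x (2 * k + 1))
      = 1 / (qpoch_inf x (x\<^sup>2) * (qpoch_inf (x ^ 8) (x ^ 20) * qpoch_inf (x ^ 12) (x ^ 20)))"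
proof -
  note nz = qpoch_inf_power_nonzero [OF x(1)]
  define R where "R k = qpoch_inf (x ^ k) (x ^ 20)" for k
  have R_nz: "R k \<noteq> 0" if "k > 0" for k unfolding R_def using nz that by simp
  define P where "P k = qpoch_inf (x ^ k) (x ^ 10)" for k
  have P_nz: "P k \<noteq> 0" if "k > 0" for k unfolding P_def using nz that by simp
  have P_R: "P k = R k * R (k + 10)" for k
    unfolding P_def R_def using qpoch_inf_power_split [OF x(1), of 10 2 k]
    by (simp add: lessThan_nat_numeral numeral_2_eq_2 mult_ac)
  have M: "qpoch_inf (- (x ^ k)) (x ^ 10) = R (2 * k) / P k" if "k > 0" for k
    unfolding P_def R_def using qpoch_inf_power_minus [OF x(1) _ that, of 10] by simp
  have s5: "qpoch_inf (x ^ k) (x ^ 5) = P k * P (k + 5)" for k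
    unfolding P_def using qpoch_inf_power_split [OF x(1), of 5 2 k]
    by (simp add: lessThan_nat_numeral numeral_2_eq_2 mult_ac)
  have s2: "qpoch_inf x (x\<^sup>2) = P 1 * P 3 * P 5 * P 7 * P 9"
    unfolding P_def using qpoch_inf_power_split [OF x(1), of 2 5 1]
    by (simp add: lessThan_nat_numeral mult_ac numeral_2_eq_2 [symmetric] del: power_Suc)
  have x5: "norm (x ^ 5) < 1" by (rule norm_power_less_one [OF x(1)]) simp
  \<comment> \<open>In base \<open>- (x ^ 5)\<close> the even-numbered factors form a product in
    base \<open>x ^ 10\<close>; the odd-numbered ones start at
    \<open>- (x ^ (k + 5))\<close>.\<close>
  have m5: "qpoch_inf (x ^ k) (- (x ^ 5)) = P k * (R (2 * (k + 5)) / P (k + 5))" for k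
    using qpoch_inf_minus_base [OF x5, of "x ^ k"] M [of "k + 5"]
    by (simp add: P_def power_add power_mult [symmetric])
  have m5': "qpoch_inf (- (x ^ k)) (- (x ^ 5)) = R (2 * k) / P k * P (k + 5)" if "k > 0" for k
    using qpoch_inf_minus_base [OF x5, of "- (x ^ k)"] M [OF that]
    by (simp add: P_def power_add power_mult [symmetric])
  note s51 = s5 [of 1, simplified] and m51' = m5' [of 1, simplified] and M1 = M [of 1, simplified]
  note R_nzs = R_nz [of 2] R_nz [of 4] R_nz [of 6] R_nz [of 8] R_nz [of 12] R_nz [of 14] R_nz [of 16] R_nz [of 18]
  note P_nzs = P_nz [of 1] P_nz [of 2] P_nz [of 3] P_nz [of 4] P_nz [of 5] P_nz [of 6] P_nz [of 7] P_nz [of 8]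
    P_nz [of 9] P_nz [of 10]
  show "(\<Sum>\<^sub>\<infinity>k. x ^ (k * k) / qpoch x x (2 * k))
      = 1 / (qpoch_inf x (x\<^sup>2) * (qpoch_inf (x ^ 4) (x ^ 20) * qpoch_inf (x ^ 16) (x ^ 20)))"
    using slater_theta_1(1) [OF x] R_nzs P_nzs
    by (simp add: R_def [symmetric] s51 s5 s2 M P_def [symmetric, of 10] P_R [of 4] P_R [of 6] field_simps)
  show "(\<Sum>\<^sub>\<infinity>k. x ^ (k * k + k) / qpoch x x (2 * k + 1))
      = 1 / (qpoch_inf x (x\<^sup>2) * (qpoch_inf (x\<^sup>2) (- (x ^ 5)) * qpoch_inf (- (x ^ 3)) (- (x ^ 5))))"
    using slater_theta_1(2) [OF x] R_nzs P_nzs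
    by (simp add: s51 s5 s2 M m5 m5' P_def [symmetric, of 10] P_R [of 4] P_R [of 6] field_simps)
  show "(\<Sum>\<^sub>\<infinity>k. x ^ (k * k + k) / qpoch x x (2 * k))
      = 1 / (qpoch_inf x (x\<^sup>2) * (qpoch_inf (- x) (- (x ^ 5)) * qpoch_inf (x ^ 4) (- (x ^ 5))))"
    using slater_theta_2(1) [OF x] R_nzs P_nzs
    by (simp add: s51 s5 s2 M m5 m51' P_def [symmetric, of 10] P_R [of 2] P_R [of 8] field_simps)
  show "(\<Sum>\<^sub>\<infinity>k. x ^ (k * k + 2 * k) / qpoch x x (2 * k + 1))
      = 1 / (qpoch_inf x (x\<^sup>2) * (qpoch_inf (x ^ 8) (x ^ 20) * qpoch_inf (x ^ 12) (x ^ 20)))"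
    using slater_theta_2(2) [OF x] R_nzs P_nzs
    by (simp add: R_def [symmetric] s51 s5 s2 M M1 P_def [symmetric, of 10] P_R [of 2] P_R [of 8] field_simps)
qed

section \<open>Reduction of the double sums\<close>

text \<open>The coefficient of \<open>z ^ n\<close> in the reciprocal of
  \<open>qpoch_inf (z\<^sup>2) (q\<^sup>2)\<close>, a series in \<open>z\<^sup>2\<close>; hence the
  zeros at odd \<open>n\<close>.\<close>

definition even_inverse_qpoch :: "complex \<Rightarrow> nat \<Rightarrow> complex" where
  "even_inverse_qpoch q n = (if even n then 1 / qpoch (q\<^sup>2) (q\<^sup>2) (n div 2) else 0)"

text \<open>The coefficient form of \<open>1 / (z; q)\<^sub>\<infinity> = (-z; q)\<^sub>\<infinity> / (z\<^sup>2; q\<^sup>2)\<^sub>\<infinity>\<close>.\<close>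
lemma inverse_qpoch_convolution:
  assumes q: "norm q < 1" "q \<noteq> 0"
  shows "(\<Sum>l\<le>i. q powi tri (int l) / qpoch q q l * even_inverse_qpoch q (i - l)) = 1 / qpoch q q i"
proof -
  have nz: "1 - q ^ Suc n \<noteq> 0" for n
    using qpoch_nonzero [OF q(1) q(1), of "Suc n"] by (simp add: qpoch_Suc)
  define a where "a l = q powi tri (int l) / qpoch q q l" for l
  define B where "B = even_inverse_qpoch q"
  define c where "c i = (\<Sum>l\<le>i. a l * B (i - l))" for i
  \<comment> \<open>With \<open>z q\<close> for \<open>z\<close> in the Euler factor only,
    \<open>d\<close> is the convolution \<open>c\<close> of the shifted series; \<open>c_d\<close>
    below expresses the factor \<open>1 + z\<close> between the two.\<close>
  define d where "d i = (\<Sum>l\<le>i. a l * q ^ l * B (i - l))" for i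
  have a_Suc: "a (Suc l) * (1 - q ^ Suc l) = a l * q ^ l" for l
    using nz [of l] q by (simp add: a_def qpoch_Suc powi_tri_Suc)
  have q2: "norm (q\<^sup>2) < 1" by (rule norm_power_less_one [OF q(1)]) simp
  have B_Suc: "B (Suc (Suc m)) * (1 - q ^ Suc (Suc m)) = B m" for m
  proof (cases "even m")
    case True
    then have "q ^ Suc (Suc m) = q\<^sup>2 * (q\<^sup>2) ^ (m div 2)"
      by (auto elim!: evenE simp: power_mult power2_eq_square)
    then show ?thesis
      using True nz [of "Suc m"] by (simp add: B_def even_inverse_qpoch_def qpoch_Suc del: power_Suc)
  next
    case False
    then show ?thesis by (simp add: B_def even_inverse_qpoch_def)
  qed
  have cd: "(\<Sum>l\<le>Suc i. a l * (1 - q ^ l) * B (Suc i - l)) = d i" for i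
    unfolding sum.atMost_Suc_shift d_def by (simp add: a_Suc del: power_Suc)
  have c_d: "c (Suc i) = d (Suc i) + d i" for i
  proof -
    have "c (Suc i) = d (Suc i) + (\<Sum>l\<le>Suc i. a l * (1 - q ^ l) * B (Suc i - l))"
      unfolding c_def d_def sum.distrib [symmetric]
      by (intro sum.cong refl) (simp only: algebra_simps, simp)
    then show ?thesis unfolding cd .
  qed
  \<comment> \<open>Splitting \<open>1 - q ^ (l + m)\<close> as
    \<open>(1 - q ^ l) + q ^ l * (1 - q ^ m)\<close> gives two sums, which the recurrences of
    \<open>a\<close> and \<open>B\<close> identify as \<open>d (Suc i)\<close> and
    \<open>d i\<close>; together they are \<open>c (Suc i)\<close>.\<close>
  have rec: "c (Suc (Suc i)) * (1 - q ^ Suc (Suc i)) = c (Suc i)" for i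
  proof -
    have B1: "B (Suc 0) = 0" by (simp add: B_def even_inverse_qpoch_def)
    have "c (Suc (Suc i)) * (1 - q ^ Suc (Suc i)) = (\<Sum>l\<le>Suc (Suc i). a l * (1 - q ^ l) * B (Suc (Suc i) - l))
        + (\<Sum>l\<le>Suc (Suc i). a l * q ^ l * (B (Suc (Suc i) - l) * (1 - q ^ (Suc (Suc i) - l))))"
      unfolding c_def sum_distrib_right sum.distrib [symmetric]
    proof (intro sum.cong refl)
      fix l assume "l \<in> {..Suc (Suc i)}"
      then have "q ^ Suc (Suc i) = q ^ l * q ^ (Suc (Suc i) - l)"
        by (simp only: power_add [symmetric] atMost_iff le_add_diff_inverse)
      then show "a l * B (Suc (Suc i) - l) * (1 - q ^ Suc (Suc i)) = a l * (1 - q ^ l) * B (Suc (Suc i) - l)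
        + a l * q ^ l * (B (Suc (Suc i) - l) * (1 - q ^ (Suc (Suc i) - l)))"
        by (simp only:) (simp only: algebra_simps mult_1_left)
    qed
    \<comment> \<open>The last two terms drop out: \<open>l = i + 1\<close> meets
      \<open>B 1 = 0\<close>, and \<open>l = i + 2\<close> meets the factor
      \<open>1 - q ^ 0\<close>.\<close>
    also have "(\<Sum>l\<le>Suc (Suc i). a l * q ^ l * (B (Suc (Suc i) - l) * (1 - q ^ (Suc (Suc i) - l))))
        = (\<Sum>l\<le>i. a l * q ^ l * (B (Suc (Suc i) - l) * (1 - q ^ (Suc (Suc i) - l))))"
      by (simp add: B1 Suc_diff_le)
    also have "\<dots> = d i"
      unfolding d_def by (intro sum.cong refl) (simp add: Suc_diff_le B_Suc del: power_Suc)
    finally show ?thesis unfolding cd c_d by simp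
  qed
  have "c i = 1 / qpoch q q i"
  proof (induction i rule: less_induct)
    case (less i)
    show ?case
    proof (cases i)
      case 0
      then show ?thesis by (simp add: c_def a_def B_def even_inverse_qpoch_def)
    next
      case i: (Suc j)
      show ?thesis
      proof (cases j)
        case 0
        then show ?thesis
          by (simp add: i c_def a_def B_def even_inverse_qpoch_def)
      next
        case (Suc k)
        have "c i = c j / (1 - q ^ i)"
          using rec [of k] nz [of j] by (simp add: i Suc nonzero_eq_divide_eq)
        then show ?thesis using less [of j] by (simp add: i qpoch_Suc)
      qed
    qed
  qed
  then show ?thesis by (simp add: c_def a_def B_def)
qed

lemma even_inverse_qpoch_bound:
  assumes q: "norm q < 1"
  obtains C where "C > 0" "\<And>n. norm (even_inverse_qpoch q n) \<le> C"
proof -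
  have "norm (q\<^sup>2) < 1" by (rule norm_power_less_one [OF q(1)]) simp
  then obtain C where C: "C > 0" "\<And>n. norm (inverse (qpoch (q\<^sup>2) (q\<^sup>2) n)) \<le> C"
    using qpoch_inverse_bound by metis
  then have "norm (even_inverse_qpoch q n) \<le> C" for n
    using C(2) [of "n div 2"] by (simp add: even_inverse_qpoch_def inverse_eq_divide)
  with C(1) that show ?thesis by blast
qed

text \<open>Expand \<open>1 / qpoch q q i\<close> by \<open>inverse_qpoch_convolution\<close> with
  \<open>i = l + n\<close>. For fixed \<open>n\<close> the sum over \<open>l\<close> and
  \<open>j\<close> has weight \<open>g (l - j + n)\<close> and falls to
  \<open>jacobi_transform\<close>.\<close>

lemma double_sum_reduction:
  assumes q: "norm q < 1" "q \<noteq> 0" and g: "g summable_on UNIV"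
  shows "(\<lambda>n. even_inverse_qpoch q n * (\<Sum>\<^sub>\<infinity>m. q powi tri m * g (m + int n))) summable_on UNIV"
    "(\<Sum>\<^sub>\<infinity>(i, j). g (int i - int j) * q powi tri (int j + 1) / (qpoch q q i * qpoch q q j))
      = (\<Sum>\<^sub>\<infinity>n. even_inverse_qpoch q n * (\<Sum>\<^sub>\<infinity>m. q powi tri m * g (m + int n))) / qpoch_inf q q"
proof -
  define B where "B = even_inverse_qpoch q"
  obtain C where C: "C > 0" "\<And>n. norm (B n) \<le> C"
    unfolding B_def using even_inverse_qpoch_bound [OF q(1)] by metis
  define J where "J n = (\<lambda>(l, j). jacobi_term q l j * g (int l - int j + int n))" for n :: nat
  define T where "T = (\<lambda>(n, p). B n * J n p)"
  have J0: "(\<lambda>(l, j). jacobi_term q l j) summable_on UNIV"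
    using jacobi_term_summable [OF q, of "\<lambda>_ _. 1" 1] by simp
  have summJ: "(\<lambda>(n, p). J n p) summable_on UNIV"
  proof -
    \<comment> \<open>The triples embed injectively into pairs of a \<open>jacobi_term\<close> index
      and an argument of \<open>g\<close>, so summability is inherited from a product
      family.\<close>
    let ?\<phi> = "\<lambda>(n :: nat, (l, j)). ((l, j), int l - int j + int n)"
    have "(\<lambda>(p, m). (case p of (l, j) \<Rightarrow> jacobi_term q l j) * g m) summable_on UNIV"
      using infsum_times(1) [OF J0 g] by simp
    then have "(\<lambda>(p, m). (case p of (l, j) \<Rightarrow> jacobi_term q l j) * g m) summable_on range ?\<phi>"
      by (rule summable_on_subset_banach) simp
    moreover have "inj ?\<phi>" by (auto simp: inj_def)
    ultimately have "((\<lambda>(p, m). (case p of (l, j) \<Rightarrow> jacobi_term q l j) * g m) \<circ> ?\<phi>) summable_on UNIV"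
      by (simp add: summable_on_reindex)
    then show ?thesis by (simp add: o_def J_def case_prod_unfold)
  qed
  have summT: "T summable_on UNIV"
  proof -
    have "(\<lambda>x. norm (case x of (n, p) \<Rightarrow> J n p)) summable_on UNIV"
      using summJ by (subst (asm) summable_on_iff_abs_summable_on_complex)
    then have "(\<lambda>x. C * norm (case x of (n, p) \<Rightarrow> J n p)) summable_on UNIV"
      by (rule summable_on_cmult_right)
    then have "(\<lambda>x. norm (T x)) summable_on UNIV"
      by (rule Infinite_Sum.abs_summable_on_comparison_test')
         (auto simp: T_def norm_mult C intro!: mult_right_mono)
    then show ?thesis by (rule abs_summable_summable)
  qed
  have inner: "(\<Sum>\<^sub>\<infinity>p. T (n, p)) = even_inverse_qpoch q n * (\<Sum>\<^sub>\<infinity>m. q powi tri m * g (m + int n)) * inverse (qpoch_inf q q)" for n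
  proof -
    have "J n summable_on UNIV"
      by (rule summable_on_SigmaD1 [where A = UNIV and B = "\<lambda>_. UNIV" and f = J]) (use summJ in auto)
    then show ?thesis
      using jacobi_transform [OF q, of "\<lambda>m. g (m + int n)"]
      by (simp add: T_def infsum_cmult_right' J_def B_def divide_inverse mult.assoc)
  qed
  have summT': "(\<lambda>(n, p). T (n, p)) summable_on UNIV \<times> UNIV" using summT by simp
  have nz: "qpoch_inf q q \<noteq> 0" by (rule qpoch_inf_nonzero [OF q(1) q(1)])
  show "(\<lambda>n. even_inverse_qpoch q n * (\<Sum>\<^sub>\<infinity>m. q powi tri m * g (m + int n))) summable_on UNIV"
    using summable_on_Sigma_banach [OF summT'] nz unfolding inner by (simp add: summable_on_cmult_left')
  have 1: "infsum T UNIV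
      = (\<Sum>\<^sub>\<infinity>n. even_inverse_qpoch q n * (\<Sum>\<^sub>\<infinity>m. q powi tri m * g (m + int n))) / qpoch_inf q q"
    using infsum_Sigma'_banach [OF summT'] unfolding inner by (simp add: infsum_cmult_left' divide_inverse)
  \<comment> \<open>The triples are regrouped by \<open>i = l + n\<close>, leaving a finite sum over
    \<open>l\<close> for each pair \<open>(i, j)\<close>.\<close>
  let ?\<psi> = "\<lambda>((i, j), l). (i - l, (l, j))"
  let ?A = "Sigma (UNIV :: (nat \<times> nat) set) (\<lambda>(i, j). {..i})"
  have bij: "bij_betw ?\<psi> ?A UNIV"
    by (rule bij_betwI [where g = "\<lambda>(n, (l, j)). ((l + n, j), l)"]) auto
  have summ\<psi>: "(\<lambda>(p, l). T (?\<psi> (p, l))) summable_on ?A"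
    using summable_on_reindex_bij_betw [OF bij, of T] summT by (simp add: case_prod_unfold)
  have "infsum T UNIV = (\<Sum>\<^sub>\<infinity>p. \<Sum>\<^sub>\<infinity>l\<in>(case p of (i, j) \<Rightarrow> {..i}). T (?\<psi> (p, l)))"
    using infsum_Sigma'_banach [OF summ\<psi>] infsum_reindex_bij_betw [OF bij, of T]
    by (simp add: case_prod_unfold)
  also have "\<dots> = (\<Sum>\<^sub>\<infinity>(i, j). g (int i - int j) * q powi tri (int j + 1) / (qpoch q q i * qpoch q q j))"
  proof (rule infsum_cong)
    fix p :: "nat \<times> nat"
    obtain i j where p: "p = (i, j)" by fastforce
    have "T (i - l, (l, j)) = g (int i - int j) * q powi tri (int j + 1) / qpoch q q j
        * (q powi tri (int l) / qpoch q q l * even_inverse_qpoch q (i - l))" if "l \<le> i" for l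
    proof -
      have e: "int l - int j + int (i - l) = int i - int j" using that by simp
      show ?thesis
        unfolding T_def J_def prod.case e using q(2)
        by (simp add: B_def jacobi_term_def power_int_add mult_ac)
    qed
    then have "(\<Sum>l\<le>i. T (i - l, (l, j))) = g (int i - int j) * q powi tri (int j + 1) / qpoch q q j * (1 / qpoch q q i)"
      unfolding inverse_qpoch_convolution [OF q, symmetric] sum_distrib_left by (intro sum.cong) auto
    then show "(\<Sum>\<^sub>\<infinity>l\<in>(case p of (i, j) \<Rightarrow> {..i}). T (?\<psi> (p, l)))
        = (case p of (i, j) \<Rightarrow> g (int i - int j) * q powi tri (int j + 1) / (qpoch q q i * qpoch q q j))"
      by (simp add: p mult.commute)
  qed
  finally show "(\<Sum>\<^sub>\<infinity>(i, j). g (int i - int j) * q powi tri (int j + 1) / (qpoch q q i * qpoch q q j))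
      = (\<Sum>\<^sub>\<infinity>n. even_inverse_qpoch q n * (\<Sum>\<^sub>\<infinity>m. q powi tri m * g (m + int n))) / qpoch_inf q q"
    using 1 by simp
qed

text \<open>Odd \<open>n\<close> contribute nothing. The even ones are split modulo 4 because
  completing the square in the applications needs a shift by about \<open>n / 4\<close>, which must
  be an integer.\<close>

lemma double_sum_parity:
  assumes q: "norm q < 1" "q \<noteq> 0" and g: "g summable_on UNIV"
  defines "\<Psi> \<equiv> \<lambda>k. \<Sum>\<^sub>\<infinity>m. q powi tri m * g (m + int k)"
  shows "(\<Sum>\<^sub>\<infinity>(i, j). g (int i - int j) * q powi tri (int j + 1) / (qpoch q q i * qpoch q q j)) * qpoch_inf q q
    = (\<Sum>\<^sub>\<infinity>l. \<Psi> (4 * l) / qpoch (q\<^sup>2) (q\<^sup>2) (2 * l)) + (\<Sum>\<^sub>\<infinity>l. \<Psi> (4 * l + 2) / qpoch (q\<^sup>2) (q\<^sup>2) (2 * l + 1))"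
proof -
  let ?f = "\<lambda>n. even_inverse_qpoch q n * \<Psi> n"
  have f: "?f summable_on UNIV"
    unfolding \<Psi>_def by (rule double_sum_reduction(1) [OF q g])
  have f2: "(\<lambda>k. ?f (2 * k)) summable_on UNIV"
  proof -
    have "?f summable_on range (\<lambda>k. 2 * k)" by (rule summable_on_subset_banach [OF f]) simp
    then show ?thesis by (subst (asm) summable_on_reindex) (auto simp: inj_def o_def)
  qed
  have "(\<Sum>\<^sub>\<infinity>n. ?f n) = (\<Sum>\<^sub>\<infinity>k. ?f (2 * k)) + (\<Sum>\<^sub>\<infinity>k. ?f (2 * k + 1))"
    by (rule infsum_nat_parity [OF f])
  also have "(\<Sum>\<^sub>\<infinity>k. ?f (2 * k + 1)) = 0"
    by (simp add: even_inverse_qpoch_def)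
  also have "(\<Sum>\<^sub>\<infinity>k. ?f (2 * k)) = (\<Sum>\<^sub>\<infinity>l. ?f (2 * (2 * l))) + (\<Sum>\<^sub>\<infinity>l. ?f (2 * (2 * l + 1)))"
    by (rule infsum_nat_parity [OF f2])
  also have "(\<lambda>l. ?f (2 * (2 * l))) = (\<lambda>l. \<Psi> (4 * l) / qpoch (q\<^sup>2) (q\<^sup>2) (2 * l))"
    by (simp add: even_inverse_qpoch_def)
  also have "(\<lambda>l. ?f (2 * (2 * l + 1))) = (\<lambda>l. \<Psi> (4 * l + 2) / qpoch (q\<^sup>2) (q\<^sup>2) (2 * l + 1))"
  proof
    fix l :: nat
    have "2 * (2 * l + 1) div 2 = 2 * l + 1" "2 * (2 * l + 1) = 4 * l + 2" by simp_all
    then show "?f (2 * (2 * l + 1)) = \<Psi> (4 * l + 2) / qpoch (q\<^sup>2) (q\<^sup>2) (2 * l + 1)"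
      by (simp add: even_inverse_qpoch_def)
  qed
  finally show ?thesis
    using double_sum_reduction(2) [OF q g] qpoch_inf_nonzero [OF q(1) q(1)] by (simp add: \<Psi>_def)
qed

section \<open>The two theta constants\<close>

lemma theta_0:
  assumes q: "norm q < 1" "q \<noteq> 0"
  shows "(\<Sum>\<^sub>\<infinity>m. (q ^ 4) powi tri m * (q\<^sup>2) powi m) = qpoch_inf (q ^ 4) (q ^ 4) * (qpoch_inf (- (q\<^sup>2)) (q ^ 4))\<^sup>2"
  using jacobi_triple_product_power [OF q, of 2 2 4] by (simp add: power2_eq_square)

text \<open>At \<open>z = 1\<close> the first factor of \<open>qpoch_inf (- 1) (q ^ 4)\<close> is 2,
  which is the source of the factors 2 in the final formulas.\<close>

lemma theta_1:
  assumes q: "norm q < 1" "q \<noteq> 0"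
  shows "(\<Sum>\<^sub>\<infinity>m. (q ^ 4) powi tri m) = 2 * (qpoch_inf (q ^ 4) (q ^ 4) * (qpoch_inf (- (q ^ 4)) (q ^ 4))\<^sup>2)"
proof -
  have q4: "norm (q ^ 4) < 1" by (rule norm_power_less_one [OF q(1)]) simp
  have "qpoch_inf (- 1) (q ^ 4) = 2 * qpoch_inf (- (q ^ 4)) (q ^ 4)"
    using qpoch_inf_add [OF q4, of "- 1" 1] by (simp add: qpoch_Suc)
  then show ?thesis
    using jacobi_triple_product [OF q4, of 1] q by (simp add: power2_eq_square)
qed

text \<open>The exponent equals \<open>tri (i - j) + 3 * tri (j + 1)\<close>, so
  \<open>double_sum_parity\<close> applies in base \<open>q ^ 3\<close>; a shift of \<open>m\<close>
  then separates \<open>m\<close> from \<open>l\<close>.\<close>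

lemma S1_double_sum:
  assumes q: "norm q < 1" "q \<noteq> 0"
  shows "S1 q * qpoch_inf (q ^ 3) (q ^ 3)
    = (\<Sum>\<^sub>\<infinity>m. (q ^ 4) powi tri m) * (\<Sum>\<^sub>\<infinity>k. (q ^ 6) ^ (k * k) / qpoch (q ^ 6) (q ^ 6) (2 * k))
    + q * (\<Sum>\<^sub>\<infinity>m. (q ^ 4) powi tri m * (q\<^sup>2) powi m)
      * (\<Sum>\<^sub>\<infinity>k. (q ^ 6) ^ (k * k + k) / qpoch (q ^ 6) (q ^ 6) (2 * k + 1))"
proof -
  define g where "g n = q powi tri n" for n
  have g: "g summable_on UNIV"
    using summable_powi_tri [OF q, of 1] by (simp add: g_def [abs_def])
  have q3: "norm (q ^ 3) < 1" "q ^ 3 \<noteq> 0"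
    using norm_power_less_one [OF q(1), of 3] q by simp_all
  have "S1 q = (\<Sum>\<^sub>\<infinity>(i, j). g (int i - int j) * (q ^ 3) powi tri (int j + 1)
      / (qpoch (q ^ 3) (q ^ 3) i * qpoch (q ^ 3) (q ^ 3) j))"
    unfolding S1_def
  proof (intro infsum_cong, clarify)
    fix i j :: nat
    have "(int i ^ 2 - int i) div 2 = tri (int i)"
      by (simp add: tri_def power2_eq_square right_diff_distrib)
    then have "2 * ((int i ^ 2 - int i) div 2 - int i * int j + 2 * int j ^ 2 + 2 * int j)
        = int i * (int i - 1) + 2 * (- int i * int j + 2 * int j ^ 2 + 2 * int j)"
      using two_tri [of "int i"] by simp
    also have "\<dots> = 2 * (tri (int i - int j) + int 3 * tri (int j + 1))"
      using two_tri [of "int i - int j"] two_tri [of "int j + 1"]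
      by (simp add: algebra_simps power2_eq_square)
    finally have e: "(int i ^ 2 - int i) div 2 - int i * int j + 2 * int j ^ 2 + 2 * int j
        = tri (int i - int j) + int 3 * tri (int j + 1)" by simp
    show "q powi ((int i ^ 2 - int i) div 2 - int i * int j + 2 * int j ^ 2 + 2 * int j)
        / (qpoch (q ^ 3) (q ^ 3) i * qpoch (q ^ 3) (q ^ 3) j)
      = g (int i - int j) * (q ^ 3) powi tri (int j + 1) / (qpoch (q ^ 3) (q ^ 3) i * qpoch (q ^ 3) (q ^ 3) j)"
      unfolding e g_def power_int_add [OF disjI1 [OF q(2)]] powi_nat_power ..
  qed
  \<comment> \<open>The shift by \<open>- l\<close> removes the mixed term:
    \<open>3 * tri (m - l) + tri (m + 3 * l) = 4 * tri m + 6 * l * l\<close>.\<close>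
  moreover have "(\<Sum>\<^sub>\<infinity>m. (q ^ 3) powi tri m * g (m + int (4 * l)))
      = (\<Sum>\<^sub>\<infinity>m. (q ^ 4) powi tri m) * (q ^ 6) ^ (l * l)" for l
  proof -
    have "(q ^ 3) powi tri (m + - int l) * g (m + - int l + int (4 * l)) = (q ^ 4) powi tri m * (q ^ 6) powi int (l * l)" for m
      unfolding g_def powi_nat_power [symmetric]
      by (rule powi_mult_eqI [OF q(2)])
         (use two_tri [of "m + - int l"] two_tri [of "m + - int l + int (4 * l)"] two_tri [of m]
          in \<open>simp add: algebra_simps\<close>)
    then show ?thesis
      by (subst infsum_int_shift [of _ "- int l", symmetric]) (simp only: power_int_of_nat infsum_cmult_left')
  qed
  \<comment> \<open>The additional 2 contributes \<open>tri 2 + 2 * (m + 3 * l)\<close> to the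
    exponent: hence the factor \<open>q\<close>, the theta argument \<open>q\<^sup>2\<close> and the
    exponent \<open>l * l + l\<close>.\<close>
  moreover have "(\<Sum>\<^sub>\<infinity>m. (q ^ 3) powi tri m * g (m + int (4 * l + 2)))
      = q * (\<Sum>\<^sub>\<infinity>m. (q ^ 4) powi tri m * (q\<^sup>2) powi m) * (q ^ 6) ^ (l * l + l)" for l
  proof -
    have "(q ^ 3) powi tri (m + - int l) * g (m + - int l + int (4 * l + 2))
        = (q ^ 4) powi tri m * (q\<^sup>2) powi m * (q * (q ^ 6) powi int (l * l + l))" for m
    proof -
      have "(q ^ 3) powi tri (m + - int l) * g (m + - int l + int (4 * l + 2))
          = q powi (int 4 * tri m + int 2 * m) * q powi (1 + int 6 * int (l * l + l))"
        unfolding g_def powi_nat_power [symmetric]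
        by (rule powi_mult_eqI [OF q(2)])
           (use two_tri [of "m + - int l"] two_tri [of "m + - int l + int (4 * l + 2)"] two_tri [of m]
            in \<open>simp add: algebra_simps\<close>)
      then show ?thesis
        unfolding power_int_add [OF disjI1 [OF q(2)]] powi_nat_power by simp
    qed
    then show ?thesis
      by (subst infsum_int_shift [of _ "- int l", symmetric]) (simp only: power_int_of_nat infsum_cmult_left', simp)
  qed
  moreover have "(q ^ 3)\<^sup>2 = q ^ 6" by simp
  ultimately show ?thesis
    using double_sum_parity [OF q3 g]
    by (simp only: times_divide_eq_right [symmetric] infsum_cmult_right')
qed

text \<open>The exponent is \<open>tri (i - j + 2) - 1 + 3 * tri (j + 1)\<close>. Moving the
  argument by 2 interchanges the two theta constants relative to
  \<open>S1_double_sum\<close>.\<close>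

lemma S2_double_sum:
  assumes q: "norm q < 1" "q \<noteq> 0"
  shows "S2 q * qpoch_inf (q ^ 3) (q ^ 3)
    = (\<Sum>\<^sub>\<infinity>m. (q ^ 4) powi tri m * (q\<^sup>2) powi m)
      * (\<Sum>\<^sub>\<infinity>k. (q ^ 6) ^ (k * k + k) / qpoch (q ^ 6) (q ^ 6) (2 * k))
    + q ^ 5 * (\<Sum>\<^sub>\<infinity>m. (q ^ 4) powi tri m)
      * (\<Sum>\<^sub>\<infinity>k. (q ^ 6) ^ (k * k + 2 * k) / qpoch (q ^ 6) (q ^ 6) (2 * k + 1))"
proof -
  define g where "g n = q powi (tri (n + 2) - 1)" for n
  have g: "g summable_on UNIV"
  proof -
    have "g = (\<lambda>n. inverse q * q powi tri (n + 2))"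
      using q(2) by (simp add: fun_eq_iff g_def power_int_diff divide_inverse mult.commute)
    moreover have "(\<lambda>n. q powi tri (n + 2)) summable_on UNIV"
      using summable_on_reindex_bij_witness [of UNIV "\<lambda>n. n - 2" "\<lambda>n. n + 2" UNIV "\<lambda>n. q powi tri n" "\<lambda>n. q powi tri (n + 2)"]
        summable_powi_tri [OF q, of 1] by simp
    ultimately show ?thesis
      by (simp only: summable_on_cmult_right)
  qed
  have q3: "norm (q ^ 3) < 1" "q ^ 3 \<noteq> 0"
    using norm_power_less_one [OF q(1), of 3] q by simp_all
  have "S2 q = (\<Sum>\<^sub>\<infinity>(i, j). g (int i - int j) * (q ^ 3) powi tri (int j + 1)
      / (qpoch (q ^ 3) (q ^ 3) i * qpoch (q ^ 3) (q ^ 3) j))"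
    unfolding S2_def
  proof (intro infsum_cong, clarify)
    fix i j :: nat
    have "int i ^ 2 + 3 * int i = 2 * (tri (int i + 2) - 1)"
      using two_tri [of "int i + 2"] by (simp add: power2_eq_square algebra_simps)
    then have "(int i ^ 2 + 3 * int i) div 2 = tri (int i + 2) - 1" by simp
    then have "2 * ((int i ^ 2 + 3 * int i) div 2 - int i * int j + 2 * int j ^ 2)
        = 2 * (tri (int i - int j + 2) - 1 + int 3 * tri (int j + 1))"
      using two_tri [of "int i + 2"] two_tri [of "int i - int j + 2"] two_tri [of "int j + 1"]
      by (simp add: algebra_simps power2_eq_square)
    then have e: "(int i ^ 2 + 3 * int i) div 2 - int i * int j + 2 * int j ^ 2
        = tri (int i - int j + 2) - 1 + int 3 * tri (int j + 1)" by simp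
    show "q powi ((int i ^ 2 + 3 * int i) div 2 - int i * int j + 2 * int j ^ 2)
        / (qpoch (q ^ 3) (q ^ 3) i * qpoch (q ^ 3) (q ^ 3) j)
      = g (int i - int j) * (q ^ 3) powi tri (int j + 1) / (qpoch (q ^ 3) (q ^ 3) i * qpoch (q ^ 3) (q ^ 3) j)"
      unfolding e g_def power_int_add [OF disjI1 [OF q(2)]] powi_nat_power ..
  qed
  moreover have "(\<Sum>\<^sub>\<infinity>m. (q ^ 3) powi tri m * g (m + int (4 * l)))
      = (\<Sum>\<^sub>\<infinity>m. (q ^ 4) powi tri m * (q\<^sup>2) powi m) * (q ^ 6) ^ (l * l + l)" for l
  proof -
    have "(q ^ 3) powi tri (m + - int l) * g (m + - int l + int (4 * l))
        = (q ^ 4) powi tri m * (q\<^sup>2) powi m * (q ^ 6) powi int (l * l + l)" for m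
    proof -
      have "(q ^ 3) powi tri (m + - int l) * g (m + - int l + int (4 * l))
          = q powi (int 4 * tri m + int 2 * m) * q powi (int 6 * int (l * l + l))"
        unfolding g_def powi_nat_power [symmetric]
        by (rule powi_mult_eqI [OF q(2)])
           (use two_tri [of "m + - int l"] two_tri [of "m + - int l + int (4 * l) + 2"] two_tri [of m]
            in \<open>simp add: algebra_simps\<close>)
      then show ?thesis
        unfolding power_int_add [OF disjI1 [OF q(2)]] powi_nat_power .
    qed
    then show ?thesis
      by (subst infsum_int_shift [of _ "- int l", symmetric]) (simp only: power_int_of_nat infsum_cmult_left')
  qed
  \<comment> \<open>The linear term \<open>4 * m\<close> turns \<open>4 * tri m\<close> into
    \<open>4 * tri (m + 1) = 4 * tri (- m)\<close>, so a reflection recovers the theta constant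
    without argument.\<close>
  moreover have "(\<Sum>\<^sub>\<infinity>m. (q ^ 3) powi tri m * g (m + int (4 * l + 2)))
      = q ^ 5 * (\<Sum>\<^sub>\<infinity>m. (q ^ 4) powi tri m) * (q ^ 6) ^ (l * l + 2 * l)" for l
  proof -
    have "(q ^ 3) powi tri (m + - int l) * g (m + - int l + int (4 * l + 2))
        = (q ^ 4) powi tri (- m) * (q ^ 5 * (q ^ 6) powi int (l * l + 2 * l))" for m
    proof -
      have "(q ^ 3) powi tri (m + - int l) * g (m + - int l + int (4 * l + 2))
          = q powi (int 4 * tri (- m)) * q powi (int 5 + int 6 * int (l * l + 2 * l))"
        unfolding g_def powi_nat_power [symmetric]
        by (rule powi_mult_eqI [OF q(2)])
           (use two_tri [of "m + - int l"] two_tri [of "m + - int l + int (4 * l + 2) + 2"] two_tri [of "- m"]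
            in \<open>simp add: algebra_simps\<close>)
      then show ?thesis
        unfolding power_int_add [OF disjI1 [OF q(2)]] powi_nat_power by simp
    qed
    then show ?thesis
      by (subst infsum_int_shift [of _ "- int l", symmetric])
         (simp only: power_int_of_nat infsum_cmult_left' infsum_int_reflect [of "\<lambda>m. (q ^ 4) powi tri m"], simp)
  qed
  moreover have "(q ^ 3)\<^sup>2 = q ^ 6" by simp
  ultimately show ?thesis
    using double_sum_parity [OF q3 g]
    by (simp only: times_divide_eq_right [symmetric] infsum_cmult_right')
qed

section \<open>The degenerate case \<open>q = 0\<close>\<close>

lemma tri_eq_0_iff: "tri n = 0 \<longleftrightarrow> n = 0 \<or> n = 1"
  using two_tri [of n] by auto

text \<open>\<open>0 powi n\<close> is 1 for \<open>n = 0\<close> and 0 otherwise. The exponent is a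
  sum of nonnegative triangular terms, which both vanish only for \<open>j = 0\<close> and
  \<open>i\<close> equal to 0 or 1.\<close>

lemma S1_0: "S1 0 = 2"
proof -
  let ?f = "\<lambda>(i, j). (0 :: complex) powi ((int i ^ 2 - int i) div 2 - int i * int j + 2 * int j ^ 2 + 2 * int j)
      / (qpoch (0 ^ 3) (0 ^ 3) i * qpoch (0 ^ 3) (0 ^ 3) j)"
  have "infsum ?f UNIV = infsum ?f {(0, 0), (1, 0)}"
  proof (rule infsum_cong_neutral)
    fix p :: "nat \<times> nat" assume p: "p \<in> UNIV - {(0, 0), (1, 0)}"
    obtain i j where ij: "p = (i, j)" by fastforce
    have "(int i ^ 2 - int i) div 2 = tri (int i)"
      by (simp add: tri_def power2_eq_square right_diff_distrib)
    then have e: "(int i ^ 2 - int i) div 2 - int i * int j + 2 * int j ^ 2 + 2 * int j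
        = tri (int i - int j) + 3 * tri (int j + 1)"
      using two_tri [of "int i"] two_tri [of "int i - int j"] two_tri [of "int j + 1"]
      by (simp add: algebra_simps power2_eq_square)
    have "tri (int i - int j) + 3 * tri (int j + 1) \<noteq> 0"
    proof
      assume "tri (int i - int j) + 3 * tri (int j + 1) = 0"
      then have "tri (int i - int j) = 0" "tri (int j + 1) = 0"
        using tri_nonneg [of "int i - int j"] tri_nonneg [of "int j + 1"] by linarith+
      then show False using p by (auto simp: ij tri_eq_0_iff)
    qed
    then show "?f p = 0" by (simp add: ij e)
  qed auto
  then show ?thesis by (simp add: S1_def qpoch_def)
qed

lemma S2_0: "S2 0 = 1"
proof -
  let ?f = "\<lambda>(i, j). (0 :: complex) powi ((int i ^ 2 + 3 * int i) div 2 - int i * int j + 2 * int j ^ 2)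
      / (qpoch (0 ^ 3) (0 ^ 3) i * qpoch (0 ^ 3) (0 ^ 3) j)"
  have "infsum ?f UNIV = infsum ?f {(0, 0)}"
  proof (rule infsum_cong_neutral)
    fix p :: "nat \<times> nat" assume p: "p \<in> UNIV - {(0, 0)}"
    obtain i j where ij: "p = (i, j)" by fastforce
    have "int i ^ 2 + 3 * int i = 2 * (tri (int i + 2) - 1)"
      using two_tri [of "int i + 2"] by (simp add: power2_eq_square algebra_simps)
    then have "(int i ^ 2 + 3 * int i) div 2 = tri (int i + 2) - 1" by simp
    then have e: "(int i ^ 2 + 3 * int i) div 2 - int i * int j + 2 * int j ^ 2
        = tri (int i - int j + 2) - 1 + 3 * tri (int j + 1)"
      using two_tri [of "int i + 2"] two_tri [of "int i - int j + 2"] two_tri [of "int j + 1"]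
      by (simp add: algebra_simps power2_eq_square)
    have "tri (int i - int j + 2) - 1 + 3 * tri (int j + 1) \<noteq> 0"
    proof
      assume *: "tri (int i - int j + 2) - 1 + 3 * tri (int j + 1) = 0"
      \<comment> \<open>A positive \<open>tri (int j + 1)\<close> would already make the exponent at
        least 2.\<close>
      then have "tri (int j + 1) = 0"
        using tri_nonneg [of "int i - int j + 2"] tri_nonneg [of "int j + 1"] by linarith
      then have j: "j = 0" by (simp add: tri_eq_0_iff)
      then have "tri (int i + 2) = 1" using * by simp
      then have "int i * (int i + 3) = 0"
        using two_tri [of "int i + 2"] by (simp add: algebra_simps)
      then show False using p j by (simp add: ij)
    qed
    then show "?f p = 0" by (simp add: ij e)
  qed auto
  then show ?thesis by (simp add: S2_def qpoch_def)
qed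

section \<open>Substituting Slater's products and the theta constants into the reduced double
  sums\<close>

theorem theorem1p3:
  fixes q :: complex
  assumes "norm q < 1"
  shows "S1 q = qpoch_inf (q^4) (q^4) / (qpoch_inf (q^3) (q^3) * qpoch_inf (q^6) (q^12)) *
           (2 * (qpoch_inf (-(q^4)) (q^4))^2 / (qpoch_inf (q^24) (q^120) * qpoch_inf (q^96) (q^120))
            + q * (qpoch_inf (-(q^2)) (q^4))^2 / (qpoch_inf (q^12) (-(q^30)) * qpoch_inf (-(q^18)) (-(q^30))))
       \<and> S2 q = qpoch_inf (q^4) (q^4) / (qpoch_inf (q^3) (q^3) * qpoch_inf (q^6) (q^12)) *
           ((qpoch_inf (-(q^2)) (q^4))^2 / (qpoch_inf (-(q^6)) (-(q^30)) * qpoch_inf (q^24) (-(q^30)))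
            + 2 * q^5 * (qpoch_inf (-(q^4)) (q^4))^2 / (qpoch_inf (q^48) (q^120) * qpoch_inf (q^72) (q^120)))"
proof (cases "q = 0")
  case True
  \<comment> \<open>At \<open>q = 0\<close> every infinite product is 1, so the right-hand sides are
    2 and 1.\<close>
  then show ?thesis by (simp add: S1_0 S2_0)
next
  case False
  note q = assms False
  have x: "norm (q ^ 6) < 1" "q ^ 6 \<noteq> 0"
    using norm_power_less_one [OF q(1), of 6] q by simp_all
  have powers: "(q ^ 6)\<^sup>2 = q ^ 12" "(q ^ 6) ^ 3 = q ^ 18" "(q ^ 6) ^ 4 = q ^ 24" "(q ^ 6) ^ 5 = q ^ 30"
    "(q ^ 6) ^ 8 = q ^ 48" "(q ^ 6) ^ 12 = q ^ 72" "(q ^ 6) ^ 16 = q ^ 96" "(q ^ 6) ^ 20 = q ^ 120"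
    by (simp_all flip: power_mult)
  have f3: "qpoch_inf (q ^ 3) (q ^ 3) \<noteq> 0"
    by (rule qpoch_inf_power_nonzero [OF q(1)]) simp_all
  \<comment> \<open>\<open>q ^ 6\<close> is the square of the base \<open>q ^ 3\<close>, so it is
    the \<open>x\<close> of the reduced sums; the common factor
    \<open>qpoch_inf x (x\<^sup>2)\<close> becomes the product in base \<open>q ^ 12\<close> of the
    prefactor.\<close>
  note slater = slater_identities [OF x, unfolded powers]
  have solve: "s * c = d \<Longrightarrow> c \<noteq> 0 \<Longrightarrow> s = d / c" for s c d :: complex
    by (simp add: field_simps)
  show ?thesis
    using solve [OF S1_double_sum [OF q] f3] solve [OF S2_double_sum [OF q] f3]
    unfolding slater theta_0 [OF q] theta_1 [OF q]
    by (simp add: add_divide_distrib distrib_left mult_ac)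
qed

end
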